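(* The two iterated limits of the normalized counting function $B_q(n)/(q^n/\sqrt{n})$ exist and agree: $$\lim_{q\to\infty}\lim_{n\to\infty}\frac{B_q(n)}{q^n/\sqrt{n}}=\frac{1}{\sqrt{\pi}}=\lim_{n\to\infty}\lim_{q\to\infty}\frac{B_q(n)}{q^n/\sqrt{n}},$$ where $q$ ranges over odd prime powers and $n$ over positive integers.
   Context: Let $q$ be an odd prime power and let $\mathcal{M}_{n,q}$ be the set of monic polynomials of degree $n$ in $\mathbb{F}_q[T]$. For $f\in\mathcal{M}_{n,q}$ put $b_q(f)=1$ if $f=A^2+TB^2$ for some $A,B\in\mathbb{F}_q[T]$, and $b_q(f)=0$ otherwise. Define $B_q(n)=\sum_{f\in\mathcal{M}_{n,q}} b_q(f)$. *)

theory Defs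
  imports Complex_Main "HOL-Algebra.Polynomial_Divisibility" "HOL-Number_Theory.Prime_Powers"
begin

text \<open>
  Since the field varies with \<open>q\<close>, it is a HOL-Algebra structure \<open>R\<close> rather than a type. Polynomials
  over \<open>R\<close> are the elements of \<open>poly_ring R\<close>: coefficient lists, leading coefficient first,
  with \<open>[]\<close> as the zero polynomial; \<open>X\<^bsub>R\<^esub>\<close> is the indeterminate \<open>T\<close>.
\<close>

text \<open>The condition \<open>f \<noteq> []\<close> is needed because the degree of \<open>[]\<close> is 0 and \<open>hd []\<close> is unspecified.\<close>

definition monic_polys :: "('a, 'b) ring_scheme \<Rightarrow> nat \<Rightarrow> 'a list set" where
  "monic_polys R n =
     {f \<in> carrier (poly_ring R).
        f \<noteq> [] \<and> Polynomials.lead_coeff f = \<one>\<^bsub>R\<^esub> \<and> Polynomials.degree f = n}"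

definition b_ind :: "('a, 'b) ring_scheme \<Rightarrow> 'a list \<Rightarrow> nat" where
  "b_ind R f =
     (if \<exists>A \<in> carrier (poly_ring R). \<exists>B \<in> carrier (poly_ring R).
           f = A [^]\<^bsub>poly_ring R\<^esub> (2::nat)
               \<oplus>\<^bsub>poly_ring R\<^esub> X\<^bsub>R\<^esub> \<otimes>\<^bsub>poly_ring R\<^esub> B [^]\<^bsub>poly_ring R\<^esub> (2::nat)
      then 1 else 0)"

definition B_count :: "('a, 'b) ring_scheme \<Rightarrow> nat \<Rightarrow> nat" where
  "B_count R n = (\<Sum>f \<in> monic_polys R n. b_ind R f)"

definition odd_prime_powers :: "nat set" where
  "odd_prime_powers = {q. odd q \<and> primepow q}"

text \<open>The filter expressing \<open>q \<rightarrow> \<infinity>\<close> with \<open>q\<close> restricted to odd prime powers.\<close>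

definition at_top_odd_prime_powers :: "nat filter" where
  "at_top_odd_prime_powers = inf at_top (principal odd_prime_powers)"

text \<open>As a limit along the trivial filter would hold vacuously, we record that this one is proper.\<close>

lemma at_top_odd_prime_powers_neq_bot: "at_top_odd_prime_powers \<noteq> bot"
proof
  assume "at_top_odd_prime_powers = bot"
  then have "eventually (\<lambda>q. q \<notin> odd_prime_powers) at_top"
    by (simp add: at_top_odd_prime_powers_def trivial_limit_def eventually_inf_principal)
  then obtain N where N: "\<And>q. q \<ge> N \<Longrightarrow> q \<notin> odd_prime_powers"
    by (auto simp: eventually_at_top_linorder)
  have "prime (3::nat)" by simp
  then have "primepow ((3::nat) ^ Suc N)"
    unfolding primepow_def by blast
  then have "(3::nat) ^ Suc N \<in> odd_prime_powers"
    by (simp add: odd_prime_powers_def)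
  moreover have "N \<le> (3::nat) ^ Suc N"
    by (rule order_trans[OF _ self_le_ge2_pow]) simp_all
  ultimately show False using N by blast
qed

end

theory Submission
  imports "HOL-Analysis.Analysis" "HOL-Real_Asymp.Real_Asymp"
    "HOL-Computational_Algebra.Formal_Laurent_Series" Defs
begin

text \<open>
  A monic irreducible \<open>p\<close> is either of the form \<open>A\<^sup>2 + TB\<^sup>2\<close> or inert, in the sense that it divides a value
  of the form only when it divides \<open>B\<close>; so \<open>f\<close> is represented iff the inert primes divide it to even
  order. By Gauss's lemma, \<open>p \<noteq> T\<close> is inert iff \<open>p(0)\<close> is a nonsquare, so the associated L-function is
  the generating function of the quadratic character of \<open>f(0)\<close>, which is 1. Comparing Euler factors,
  the generating function \<open>D(u)\<close> of \<open>B\<^sub>q(n)\<close> satisfies \<open>D(u)\<^sup>2(1 - qu) = (1 + u)D(u\<^sup>2)\<close>.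

  Hence \<open>D(u) = (1 - qu)\<^sup>-\<^sup>1\<^sup>/\<^sup>2 H(u)\<close>, and the logarithmic derivative of the equation shows that the
  coefficients of \<open>H\<close> satisfy \<open>0 \<le> h\<^sub>k \<le> q\<^sup>k\<^sup>/\<^sup>2\<close> with \<open>h\<^sub>0 = 1\<close>. So \<open>B\<^sub>q(n)/q\<^sup>n\<close> is the convolution of
  \<open>h\<^sub>k/q\<^sup>k\<close> with \<open>binom(2n, n)/4\<^sup>n\<close>, which is asymptotic to \<open>1/sqrt(\<pi>n)\<close>; both iterated limits follow, since
  the terms \<open>k \<ge> 1\<close> vanish uniformly as \<open>q\<close> grows.
\<close>

unbundle no vec_syntax

section \<open>Binary forms over a domain\<close>

context domain
begin

text \<open>Put \<open>S^2 = -T\<close>. Then \<open>A^2 + T B^2\<close> is the norm of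
  \<open>A + S B\<close> from \<open>F_q[S]\<close>, again a principal ideal domain; this is the
  conceptual source of the dichotomy for primes. The argument nevertheless stays inside
  \<open>F_q[T]\<close>: descent replaces factorisation upstairs, and a pigeonhole replaces the
  construction of a generator. Units do no harm, since an even-degree and an odd-degree term cannot
  cancel at the top: leading coefficients of values are squares, so a monic prime itself, and not
  just a constant multiple of it, is represented.

  The L-function is 1 because in degree at least 1 the constant term is equidistributed over the
  field.

  No singularity analysis is needed. The exponent \<open>k/2\<close> reflects that
  \<open>D(u^2)\<close> is first singular at \<open>|u| = q^(-1/2)\<close>, but the bound is proved
  by induction on coefficients: taking logarithmic derivatives makes the multiplicative equation
  additive. Its uniformity in \<open>q\<close> is what lets one expansion serve both orders of the
  limits.\<close>

definition qform :: "'a \<Rightarrow> 'a \<Rightarrow> bool" where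
  "qform t f \<longleftrightarrow> (\<exists>A\<in>carrier R. \<exists>B\<in>carrier R. f = A \<otimes> A \<oplus> t \<otimes> (B \<otimes> B))"

text \<open>Brahmagupta's identity, that is, multiplicativity of the norm of \<open>a + s b\<close>
  with \<open>s^2 = -t\<close>.\<close>

lemma qform_mult:
  assumes t: "t \<in> carrier R" and "qform t f" "qform t g"
  shows "qform t (f \<otimes> g)"
proof -
  obtain a b c d where abcd: "a \<in> carrier R" "b \<in> carrier R" "c \<in> carrier R" "d \<in> carrier R"
    "f = a \<otimes> a \<oplus> t \<otimes> (b \<otimes> b)" "g = c \<otimes> c \<oplus> t \<otimes> (d \<otimes> d)"
    using assms(2,3) unfolding qform_def by blast
  have "f \<otimes> g = ((a \<otimes> c \<ominus> t \<otimes> b \<otimes> d) \<otimes> (a \<otimes> c \<ominus> t \<otimes> b \<otimes> d)) \<oplus> t \<otimes> ((a \<otimes> d \<oplus> b \<otimes> c) \<otimes> (a \<otimes> d \<oplus> b \<otimes> c))"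
    using abcd(1-4) t unfolding abcd(5,6) by algebra
  then show ?thesis using abcd(1-4) t unfolding qform_def by blast
qed

lemma qform_square:
  assumes t: "t \<in> carrier R" and "g \<in> carrier R"
  shows "qform t (g \<otimes> g)"
proof -
  have "g \<otimes> g = g \<otimes> g \<oplus> t \<otimes> (\<zero> \<otimes> \<zero>)"
    using assms by algebra
  then show ?thesis using assms unfolding qform_def by blast
qed

text \<open>Fermat's descent: if \<open>p = a\<^sup>2 + tb\<^sup>2\<close> divides \<open>A\<^sup>2 + tB\<^sup>2\<close>, it divides \<open>aB - Ab\<close> or \<open>aB + Ab\<close>;
  for the right sign both squares in the product formula for \<open>(A\<^sup>2 + tB\<^sup>2)p\<close> are divisible by \<open>p\<^sup>2\<close>.\<close>

lemma qform_descent: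
  assumes t: "t \<in> carrier R" and p: "ring_prime p" "p \<in> carrier R" and g: "g \<in> carrier R"
    and qp: "qform t p" and qpg: "qform t (p \<otimes> g)"
  shows "qform t g"
proof -
  obtain a b where ab: "a \<in> carrier R" "b \<in> carrier R" "p = a \<otimes> a \<oplus> t \<otimes> (b \<otimes> b)"
    using qp unfolding qform_def by blast
  obtain A B where AB: "A \<in> carrier R" "B \<in> carrier R"
    and pg: "p \<otimes> g = A \<otimes> A \<oplus> t \<otimes> (B \<otimes> B)"
    using qpg unfolding qform_def by blast
  have p0: "p \<noteq> \<zero>" and pr: "Divisibility.prime R p" using p by (auto simp: ring_prime_def)
  have prd: "p divides x \<or> p divides y" if "p divides (x \<otimes> y)" "x \<in> carrier R" "y \<in> carrier R" for x y
    using pr that unfolding Divisibility.prime_def by blast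
  \<comment> \<open>\<open>C\<close> stands for \<open>A\<close> or \<open>\<ominus> A\<close>, so
    that both signs are covered by one argument.\<close>
  have key: "qform t g" if C: "C \<in> carrier R" "C \<otimes> C = A \<otimes> A"
    and d: "p divides (a \<otimes> B \<ominus> C \<otimes> b)" for C
  proof -
    obtain v where v: "v \<in> carrier R" "a \<otimes> B \<ominus> C \<otimes> b = p \<otimes> v" using d by (auto elim: dividesE)
    have "p \<otimes> (p \<otimes> g) = (C \<otimes> a \<oplus> t \<otimes> B \<otimes> b) \<otimes> (C \<otimes> a \<oplus> t \<otimes> B \<otimes> b) \<oplus> t \<otimes> ((a \<otimes> B \<ominus> C \<otimes> b) \<otimes> (a \<otimes> B \<ominus> C \<otimes> b))"
      unfolding pg C(2)[symmetric] unfolding ab(3) using C(1) AB ab(1,2) t by algebra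
    then have "p \<otimes> (p \<otimes> g) = (C \<otimes> a \<oplus> t \<otimes> B \<otimes> b) \<otimes> (C \<otimes> a \<oplus> t \<otimes> B \<otimes> b) \<oplus> t \<otimes> ((p \<otimes> v) \<otimes> (p \<otimes> v))"
      unfolding v(2) .
    then have e: "(C \<otimes> a \<oplus> t \<otimes> B \<otimes> b) \<otimes> (C \<otimes> a \<oplus> t \<otimes> B \<otimes> b) = p \<otimes> (p \<otimes> g \<ominus> t \<otimes> p \<otimes> v \<otimes> v)"
      using C(1) AB ab(1,2) t v(1) p(2) g by algebra
    have cc: "C \<otimes> a \<oplus> t \<otimes> B \<otimes> b \<in> carrier R" using C(1) AB ab(1,2) t by simp
    have "p divides (C \<otimes> a \<oplus> t \<otimes> B \<otimes> b)"
      using prd[OF _ cc cc] e p(2) g t v(1) by (metis dividesI m_closed minus_closed)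
    then obtain u where u: "u \<in> carrier R" "C \<otimes> a \<oplus> t \<otimes> B \<otimes> b = p \<otimes> u" by (auto elim: dividesE)
    have "(p \<otimes> p) \<otimes> g = (p \<otimes> p) \<otimes> (u \<otimes> u \<oplus> t \<otimes> (v \<otimes> v))"
      using e u(1) v(1) p(2) g t unfolding u(2) by algebra
    moreover have "p \<otimes> p \<noteq> \<zero>" using p0 p(2) integral by blast
    ultimately have "g = u \<otimes> u \<oplus> t \<otimes> (v \<otimes> v)"
      using m_lcancel[of "p \<otimes> p" g "u \<otimes> u \<oplus> t \<otimes> (v \<otimes> v)"] u(1) v(1) p(2) g t by simp
    then show ?thesis using u(1) v(1) unfolding qform_def by blast
  qed
  \<comment> \<open>The product is \<open>a^2 B^2 - A^2 b^2\<close>; eliminating \<open>a^2\<close>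
    and \<open>A^2\<close> by the two representations leaves
    \<open>p B^2 - b^2 (p g)\<close>.\<close>
  have "(a \<otimes> B \<ominus> A \<otimes> b) \<otimes> (a \<otimes> B \<ominus> (\<ominus> A) \<otimes> b) = (a \<otimes> a \<oplus> t \<otimes> (b \<otimes> b)) \<otimes> B \<otimes> B \<ominus> b \<otimes> b \<otimes> (A \<otimes> A \<oplus> t \<otimes> (B \<otimes> B))"
    using AB ab(1,2) t by algebra
  also have "\<dots> = p \<otimes> (B \<otimes> B \<ominus> b \<otimes> b \<otimes> g)"
    unfolding pg[symmetric] ab(3)[symmetric] using AB ab(1,2) t p(2) g by algebra
  finally have "p divides ((a \<otimes> B \<ominus> A \<otimes> b) \<otimes> (a \<otimes> B \<ominus> (\<ominus> A) \<otimes> b))"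
    using dividesI[of "B \<otimes> B \<ominus> b \<otimes> b \<otimes> g" R _ p] AB ab(1,2) g by simp
  then have "p divides (a \<otimes> B \<ominus> A \<otimes> b) \<or> p divides (a \<otimes> B \<ominus> (\<ominus> A) \<otimes> b)"
    using prd AB ab(1,2) by simp
  then show ?thesis
  proof
    assume "p divides (a \<otimes> B \<ominus> A \<otimes> b)"
    then show ?thesis using key AB by blast
  next
    assume d: "p divides (a \<otimes> B \<ominus> (\<ominus> A) \<otimes> b)"
    have "(\<ominus> A) \<otimes> (\<ominus> A) = A \<otimes> A" using AB by algebra
    then show ?thesis using key d AB by blast
  qed
qed

text \<open>For a prime \<open>p\<close> this says, without division, that \<open>-t\<close> is not
  a square in the fraction field of the quotient by \<open>p\<close>. In particular a prime
  \<open>t\<close> is not inert with respect to itself.\<close>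

definition inert :: "'a \<Rightarrow> 'a \<Rightarrow> bool" where
  "inert t p \<longleftrightarrow> (\<forall>A\<in>carrier R. \<forall>B\<in>carrier R.
     p divides (A \<otimes> A \<oplus> t \<otimes> (B \<otimes> B)) \<longrightarrow> p divides B)"

text \<open>Once \<open>p\<close> divides \<open>B\<close> it divides \<open>A^2\<close>, hence
  \<open>A\<close>; then the whole value is divisible by \<open>p^2\<close> and both coordinates can
  be divided by \<open>p\<close>. So inert primes come off in pairs.\<close>

lemma qform_inert:
  assumes t: "t \<in> carrier R" and p: "ring_prime p" "p \<in> carrier R" and g: "g \<in> carrier R"
    and inert: "inert t p"
    and q: "qform t (p \<otimes> g)"
  shows "\<exists>h\<in>carrier R. g = p \<otimes> h \<and> qform t h"
proof -
  obtain A B where AB: "A \<in> carrier R" "B \<in> carrier R"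
    and pg: "p \<otimes> g = A \<otimes> A \<oplus> t \<otimes> (B \<otimes> B)"
    using q unfolding qform_def by blast
  have p0: "p \<noteq> \<zero>" and pr: "Divisibility.prime R p" using p by (auto simp: ring_prime_def)
  have prd: "p divides x \<or> p divides y" if "p divides (x \<otimes> y)" "x \<in> carrier R" "y \<in> carrier R" for x y
    using pr that unfolding Divisibility.prime_def by blast
  have "p divides (A \<otimes> A \<oplus> t \<otimes> (B \<otimes> B))" using pg g by (metis dividesI)
  then have "p divides B" using inert AB unfolding inert_def by blast
  then obtain v where v: "v \<in> carrier R" "B = p \<otimes> v" by (auto elim: dividesE)
  have e: "A \<otimes> A = p \<otimes> (g \<ominus> t \<otimes> p \<otimes> v \<otimes> v)"
    using pg AB(1) t v(1) p(2) g unfolding v(2) by algebra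
  then have "p divides A" using prd AB(1) t v(1) p(2) g by (metis dividesI m_closed minus_closed)
  then obtain u where u: "u \<in> carrier R" "A = p \<otimes> u" by (auto elim: dividesE)
  have "p \<otimes> g = p \<otimes> (p \<otimes> (u \<otimes> u \<oplus> t \<otimes> (v \<otimes> v)))"
    using pg u(1) v(1) p(2) g t unfolding u(2) v(2) by algebra
  then have "g = p \<otimes> (u \<otimes> u \<oplus> t \<otimes> (v \<otimes> v))"
    using m_lcancel[OF p0 p(2) g] u(1) v(1) p(2) t by simp
  then show ?thesis using u(1) v(1) t unfolding qform_def by blast
qed

text \<open>Induction in steps of two: a pair of factors \<open>p\<close> is removed by
  \<open>qform_inert\<close> and restored as a square. A single factor \<open>p\<close> is
  impossible, as it would force a second one.\<close>

lemma qform_prime_power_inert: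
  assumes t: "t \<in> carrier R" and p: "ring_prime p" "p \<in> carrier R" and g: "g \<in> carrier R"
    and inert: "inert t p"
    and ndvd: "\<not> p divides g"
  shows "qform t (p [^] (k::nat) \<otimes> g) \<longleftrightarrow> even k \<and> qform t g"
proof (induction k rule: less_induct)
  case (less k)
  have p0: "p \<noteq> \<zero>" using p by (auto simp: ring_prime_def)
  consider "k = 0" | "k = 1" | j where "k = Suc (Suc j)"
    by (metis One_nat_def not0_implies_Suc)
  then show ?case
  proof cases
    case 1 then show ?thesis using g by simp
  next
    case 2
    have "\<not> qform t (p \<otimes> g)"
      using qform_inert[OF t p g inert] ndvd dividesI by blast
    then show ?thesis using 2 p by simp
  next
    case 3
    let ?h = "p [^] j \<otimes> g"
    have h: "?h \<in> carrier R" using p g by simp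
    have e: "p [^] k \<otimes> g = p \<otimes> (p \<otimes> ?h)" "p [^] k \<otimes> g = (p \<otimes> p) \<otimes> ?h"
      using p(2) g unfolding 3 by (simp_all add: m_assoc m_comm m_lcomm)
    have "qform t (p [^] k \<otimes> g) \<longleftrightarrow> qform t ?h"
    proof
      assume "qform t (p [^] k \<otimes> g)"
      then obtain x where x: "x \<in> carrier R" "p \<otimes> ?h = p \<otimes> x" "qform t x"
        using qform_inert[OF t p _ inert, of "p \<otimes> ?h"] p(2) h unfolding e(1) by auto
      then show "qform t ?h" using m_lcancel[OF p0 p(2) h x(1)] by simp
    next
      assume "qform t ?h"
      then show "qform t (p [^] k \<otimes> g)" unfolding e(2) using qform_mult qform_square t p(2) by blast
    qed
    then show ?thesis using less.IH[of j] 3 by simp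
  qed
qed

lemma qform_prime_power:
  assumes t: "t \<in> carrier R" and p: "ring_prime p" "p \<in> carrier R" and g: "g \<in> carrier R"
    and qp: "qform t p"
  shows "qform t (p [^] (k::nat) \<otimes> g) \<longleftrightarrow> qform t g"
proof (induction k)
  case 0 then show ?case using g by simp
next
  case (Suc k)
  let ?h = "p [^] k \<otimes> g"
  have h: "?h \<in> carrier R" and e: "p [^] Suc k \<otimes> g = p \<otimes> ?h" using p g by (simp_all add: m_assoc m_comm m_lcomm)
  show ?case unfolding e using Suc qform_mult[OF t qp] qform_descent[OF t p h qp] by blast
qed

end

section \<open>Finite fields of odd order\<close>

text \<open>A locale over structures, because it is needed twice: for the base field and, in
  \<open>minus_X_square\<close>, for the residue field of a prime.\<close>

locale odd_finite_field = field +
  assumes fin: "finite (carrier R)" and odd_order: "odd (order R)"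
begin

definition half :: nat where "half = (order R - 1) div 2"

text \<open>The quadratic character, encoded by Euler's criterion; real-valued, so that it can serve
  as a weight in Euler products.\<close>

definition qchar :: "'a \<Rightarrow> real" where
  "qchar x = (if x = \<zero> then 0 else if x [^] half = \<one> then 1 else - 1)"

lemma order_gt_2: "order R > 2"
proof -
  have "card {\<zero>, \<one>} \<le> order R" unfolding order_def using fin by (intro card_mono) auto
  then have "order R \<ge> 2" by simp
  then show ?thesis using odd_order by (cases "order R = 2") auto
qed

lemma two_half: "2 * half = order R - 1" and half_pos: "half > 0"
  using odd_order order_gt_2 unfolding half_def by auto

text \<open>Cyclicity of the unit group together with the exact order of a generator: squareness can
  then be read off the parity of an exponent.\<close>

lemma unit_generator:
  obtains g where "g \<in> carrier R" "g \<noteq> \<zero>"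
    "\<And>x. x \<in> carrier R \<Longrightarrow> x \<noteq> \<zero> \<Longrightarrow> \<exists>i::nat. x = g [^] i"
    "\<And>i::nat. g [^] i = \<one> \<longleftrightarrow> order R - 1 dvd i"
proof -
  interpret G: group "Multiplicative_Group.mult_of R"
    rewrites "([^]\<^bsub>Multiplicative_Group.mult_of R\<^esub>) = (([^]) :: _ \<Rightarrow> nat \<Rightarrow> _)" and "\<one>\<^bsub>Multiplicative_Group.mult_of R\<^esub> = \<one>"
    by (rule field_mult_group) (simp_all add: fun_eq_iff nat_pow_def)
  obtain g where g: "g \<in> carrier (Multiplicative_Group.mult_of R)"
    "carrier (Multiplicative_Group.mult_of R) = {g [^] i | i::nat. i \<in> UNIV}"
    using finite_field_mult_group_has_gen[OF fin] by blast
  have finG: "finite (carrier (Multiplicative_Group.mult_of R))" using fin by (rule finite_mult_of)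
  have o: "order (Multiplicative_Group.mult_of R) = order R - 1" using fin by (rule order_mult_of)
  have op: "0 < order R - 1" using order_gt_2 by simp
  \<comment> \<open>That the order of \<open>g\<close> is all of \<open>q - 1\<close> follows by
    counting: the powers of \<open>g\<close> exhaust the group, and there are at most
    \<open>ord g\<close> of them.\<close>
  have "carrier (Multiplicative_Group.mult_of R) = {g [^] i | i. i \<in> {0..G.ord g - 1}}"
    using G.ord_elems[OF finG g(1)] g(2) by simp
  also have "\<dots> = (\<lambda>i. g [^] i) ` {0..G.ord g - 1}" by auto
  finally have "order (Multiplicative_Group.mult_of R) \<le> card {0..G.ord g - 1}"
    unfolding order_def using card_image_le[of "{0..G.ord g - 1}" "\<lambda>i. g [^] i"] by simp
  then have "order R - 1 \<le> G.ord g" using o G.ord_ge_1[OF finG g(1)] by simp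
  moreover have "G.ord g dvd order R - 1" using G.ord_dvd_group_order[OF g(1)] o by simp
  ultimately have "G.ord g = order R - 1" using op by (simp add: dvd_imp_le le_antisym)
  then have "\<And>i::nat. g [^] i = \<one> \<longleftrightarrow> order R - 1 dvd i"
    using G.pow_eq_id[OF g(1)] by simp
  then show ?thesis using that g by auto
qed

lemma pow_order: assumes "x \<in> carrier R" "x \<noteq> \<zero>" shows "x [^] (order R - 1) = \<one>"
proof -
  obtain g where g: "g \<in> carrier R"
    "\<And>x. x \<in> carrier R \<Longrightarrow> x \<noteq> \<zero> \<Longrightarrow> \<exists>i::nat. x = g [^] i"
    "\<And>i::nat. g [^] i = \<one> \<longleftrightarrow> order R - 1 dvd i" using unit_generator by metis
  obtain i :: nat where "x = g [^] i" using g assms by blast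
  then show ?thesis using g(1,3) by (simp add: nat_pow_pow)
qed

lemma pow_half: assumes "x \<in> carrier R" "x \<noteq> \<zero>" shows "x [^] half = \<one> \<or> x [^] half = \<ominus> \<one>"
proof (rule square_eq_one)
  show "x [^] half \<otimes> x [^] half = \<one>"
    using pow_order[OF assms] assms(1) two_half by (simp add: nat_pow_mult mult_2)
qed (use assms in auto)

lemma nonsquare_exists: "\<exists>g\<in>carrier R. g \<noteq> \<zero> \<and> g [^] half \<noteq> \<one>"
proof -
  obtain g where g: "g \<in> carrier R" "g \<noteq> \<zero>"
    "\<And>i::nat. g [^] i = \<one> \<longleftrightarrow> order R - 1 dvd i" using unit_generator by metis
  have "\<not> order R - 1 dvd half" using two_half half_pos by (auto dest!: dvd_imp_le)
  then show ?thesis using g by blast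
qed

lemma minus_one_neq_one: "\<ominus> \<one> \<noteq> \<one>"
  using nonsquare_exists pow_half by metis

text \<open>Writing \<open>x = g^i\<close>, the hypothesis says that \<open>2 * half\<close> divides
  \<open>i * half\<close>, so \<open>i\<close> is even.\<close>

lemma square_if_pow_half:
  assumes "x \<in> carrier R" "x [^] half = \<one>"
  shows "\<exists>y\<in>carrier R. x = y \<otimes> y"
proof (cases "x = \<zero>")
  case True then show ?thesis by (intro bexI[of _ \<zero>]) auto
next
  case False
  obtain g where g: "g \<in> carrier R"
    "\<And>x. x \<in> carrier R \<Longrightarrow> x \<noteq> \<zero> \<Longrightarrow> \<exists>i::nat. x = g [^] i"
    "\<And>i::nat. g [^] i = \<one> \<longleftrightarrow> order R - 1 dvd i" using unit_generator by metis
  obtain i :: nat where i: "x = g [^] i" using g assms False by blast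
  have "order R - 1 dvd i * half" using assms(2) i g(1) g(3)[of "i * half"] by (simp add: nat_pow_pow)
  then have "2 * half dvd i * half" unfolding two_half .
  then have "even i" using half_pos by simp
  then have "x = g [^] (i div 2) \<otimes> g [^] (i div 2)" using i g(1) by (auto simp: nat_pow_mult mult_2 elim!: evenE)
  then show ?thesis using g(1) by blast
qed

lemma qchar_one [simp]: "qchar \<one> = 1"
  by (simp add: qchar_def)

lemma qchar_zero [simp]: "qchar \<zero> = 0"
  by (simp add: qchar_def)

lemma qchar_mult:
  assumes "x \<in> carrier R" "y \<in> carrier R"
  shows "qchar (x \<otimes> y) = qchar x * qchar y"
proof (cases "x = \<zero> \<or> y = \<zero>")
  case True then show ?thesis using assms by (auto simp: qchar_def)
next
  case False
  then have "x \<otimes> y \<noteq> \<zero>" using assms integral by blast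
  moreover have "(x \<otimes> y) [^] half = x [^] half \<otimes> y [^] half" using assms by (rule nat_pow_distrib)
  moreover have "(\<ominus> \<one>) \<otimes> (\<ominus> \<one>) = \<one>" by algebra
  ultimately show ?thesis using False pow_half[OF assms(1)] pow_half[OF assms(2)] minus_one_neq_one
    by (auto simp: qchar_def)
qed

lemma qchar_square: assumes "x \<in> carrier R" "x \<noteq> \<zero>" shows "qchar (x \<otimes> x) = 1"
  unfolding qchar_mult[OF assms(1,1)] using assms(2) by (auto simp: qchar_def)

lemma qchar_cases: "x \<noteq> \<zero> \<Longrightarrow> qchar x = 1 \<or> qchar x = - 1"
  by (auto simp: qchar_def)

text \<open>Multiplication by a nonsquare permutes the field and reverses all signs.\<close>

lemma sum_qchar: "(\<Sum>x\<in>carrier R. qchar x) = 0"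
proof -
  obtain g where g: "g \<in> carrier R" "g \<noteq> \<zero>" "qchar g = -1"
    using nonsquare_exists by (auto simp: qchar_def)
  have inj: "inj_on (\<lambda>x. g \<otimes> x) (carrier R)" using m_lcancel[OF g(2,1)] by (auto intro: inj_onI)
  have "(\<lambda>x. g \<otimes> x) ` carrier R = carrier R"
    by (rule endo_inj_surj[OF fin _ inj]) (use g in auto)
  then have "(\<Sum>x\<in>carrier R. qchar x) = (\<Sum>x\<in>carrier R. qchar (g \<otimes> x))"
    by (metis (no_types, lifting) inj sum.reindex_cong)
  also have "\<dots> = - (\<Sum>x\<in>carrier R. qchar x)"
    by (simp add: qchar_mult g sum_negf cong: sum.cong)
  finally show ?thesis by simp
qed

lemma card_nonsquares: "card {x \<in> carrier R. qchar x = -1} = half"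
proof -
  let ?P = "{x \<in> carrier R. qchar x = 1}" and ?N = "{x \<in> carrier R. qchar x = -1}"
  have C: "carrier R = {\<zero>} \<union> ?P \<union> ?N" using qchar_cases by auto
  have "0 = (\<Sum>x\<in>{\<zero>} \<union> ?P \<union> ?N. qchar x)" using sum_qchar C by simp
  also have "\<dots> = (\<Sum>x\<in>{\<zero>}. qchar x) + (\<Sum>x\<in>?P. qchar x) + (\<Sum>x\<in>?N. qchar x)"
    using fin by (subst sum.union_disjoint sum.union_disjoint; auto)+
  also have "\<dots> = real (card ?P) - real (card ?N)" by simp
  finally have "card ?P = card ?N" by simp
  moreover have "order R = card ({\<zero>} \<union> ?P \<union> ?N)" unfolding order_def using C by simp
  then have "order R = 1 + card ?P + card ?N"
    using fin by (subst (asm) card_Un_disjoint card_Un_disjoint; auto)+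
  ultimately show ?thesis using two_half by simp
qed

lemma qchar_minus_one: "qchar (\<ominus> \<one>) = (- 1) ^ half"
proof -
  have "(\<ominus> \<one>) \<otimes> (\<ominus> \<one>) = \<one>" by algebra
  then have "(\<ominus> \<one>) [^] n = (if even n then \<one> else \<ominus> \<one>)" for n :: nat
    by (induction n) auto
  then show ?thesis using minus_one_neq_one by (auto simp: qchar_def)
qed

end

section \<open>Monic polynomials over a finite field\<close>

context odd_finite_field
begin

abbreviation P where "P \<equiv> poly_ring R"

sublocale UP: principal_domain P
  using univ_poly_is_principal[OF carrier_is_subfield] .

definition monic :: "'a list \<Rightarrow> bool" where
  "monic f \<longleftrightarrow> f \<in> carrier P \<and> f \<noteq> [] \<and> hd f = \<one>"

definition mprime :: "'a list \<Rightarrow> bool" where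
  "mprime p \<longleftrightarrow> monic p \<and> ring_prime\<^bsub>P\<^esub> p"

lemma poly_carrier_iff: "f \<in> carrier P \<longleftrightarrow> set f \<subseteq> carrier R \<and> (f \<noteq> [] \<longrightarrow> hd f \<noteq> \<zero>)"
  by (auto simp: polynomial_def simp flip: univ_poly_carrier)

lemma monic_polys_eq: "monic_polys R n = {f. monic f \<and> degree f = n}"
  by (auto simp: monic_polys_def monic_def)

lemma X_carrier [simp]: "X \<in> carrier P"
  using var_closed(1)[OF carrier_is_subring] .

text \<open>Sizes are mostly measured by length instead of degree, since the degree does not
  separate the zero polynomial from the nonzero constants.\<close>

lemma length_mult:
  assumes "f \<in> carrier P" "g \<in> carrier P" "f \<noteq> []" "g \<noteq> []"
  shows "f \<otimes>\<^bsub>P\<^esub> g \<noteq> []" "length (f \<otimes>\<^bsub>P\<^esub> g) = length f + length g - 1"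
proof -
  show n: "f \<otimes>\<^bsub>P\<^esub> g \<noteq> []" using UP.integral[of f g] assms unfolding univ_poly_zero by blast
  have "degree (f \<otimes>\<^bsub>P\<^esub> g) = degree f + degree g"
    using poly_mult_degree_eq[OF carrier_is_subring, of f g] assms
    by (simp add: univ_poly_mult univ_poly_carrier)
  moreover have "length f > 0" "length g > 0" "length (f \<otimes>\<^bsub>P\<^esub> g) > 0" using assms(3,4) n by auto
  ultimately show "length (f \<otimes>\<^bsub>P\<^esub> g) = length f + length g - 1" by linarith
qed

lemma hd_mult:
  assumes "f \<in> carrier P" "g \<in> carrier P" "f \<noteq> []" "g \<noteq> []"
  shows "hd (f \<otimes>\<^bsub>P\<^esub> g) = hd f \<otimes> hd g"
  using poly_mult_lead_coeff[OF carrier_is_subring, of f g] assms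
  by (simp add: univ_poly_mult univ_poly_carrier)

text \<open>The padded shorter list begins with a zero, so the leading coefficient of
  \<open>f\<close> survives and normalisation removes nothing.\<close>

lemma add_longer:
  assumes "f \<in> carrier P" "g \<in> carrier P" "length g < length f"
  shows "hd (f \<oplus>\<^bsub>P\<^esub> g) = hd f" "length (f \<oplus>\<^bsub>P\<^esub> g) = length f"
proof -
  let ?g = "replicate (length f - length g) \<zero> @ g"
  obtain a f' where f: "f = a # f'" using assms(3) by (cases f) auto
  obtain g' where g: "?g = \<zero> # g'" using assms(3) by (cases "length f - length g") auto
  have a: "a \<in> carrier R" "a \<noteq> \<zero>" using assms(1) unfolding poly_carrier_iff f by auto
  have "f \<oplus>\<^bsub>P\<^esub> g = normalize (map2 (\<oplus>) f ?g)"
    using assms(3) by (simp add: univ_poly_add)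
  also have "\<dots> = map2 (\<oplus>) f ?g" unfolding g unfolding f using a by simp
  finally have e: "f \<oplus>\<^bsub>P\<^esub> g = map2 (\<oplus>) f ?g" .
  show "hd (f \<oplus>\<^bsub>P\<^esub> g) = hd f" unfolding e g unfolding f using a by simp
  show "length (f \<oplus>\<^bsub>P\<^esub> g) = length f" unfolding e using assms(3) by simp
qed

lemma length_add_le: "length (f \<oplus>\<^bsub>P\<^esub> g) \<le> max (length f) (length g)"
  unfolding univ_poly_add by (rule poly_add_length_le)

lemma length_minus_le:
  assumes "g \<in> carrier P" shows "length (f \<ominus>\<^bsub>P\<^esub> g) \<le> max (length f) (length g)"
  using length_add_le[of f "\<ominus>\<^bsub>P\<^esub> g"] univ_poly_a_inv_length[OF carrier_is_subring assms]
  by (simp add: a_minus_def)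

lemma monic_mult: "monic f \<Longrightarrow> monic g \<Longrightarrow> monic (f \<otimes>\<^bsub>P\<^esub> g)"
  unfolding monic_def using length_mult(1) hd_mult by auto

lemma monic_cancel: "monic f \<Longrightarrow> g \<in> carrier P \<Longrightarrow> monic (f \<otimes>\<^bsub>P\<^esub> g) \<Longrightarrow> monic g"
proof -
  assume a: "monic f" "g \<in> carrier P" "monic (f \<otimes>\<^bsub>P\<^esub> g)"
  have "g \<noteq> []" using a UP.r_null[of f] unfolding univ_poly_zero monic_def by auto
  then have "hd g \<in> carrier R" using a(2) unfolding poly_carrier_iff by auto
  then show ?thesis using a \<open>g \<noteq> []\<close> hd_mult[of f g] unfolding monic_def by auto
qed

lemma monic_one: "monic \<one>\<^bsub>P\<^esub>"
  unfolding monic_def using UP.one_closed by (simp add: univ_poly_one)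

lemma monic_pow: "monic f \<Longrightarrow> monic (f [^]\<^bsub>P\<^esub> (k::nat))"
  by (induction k) (auto simp: monic_one monic_mult)

lemma degree_mult:
  assumes "monic f" "monic g" shows "degree (f \<otimes>\<^bsub>P\<^esub> g) = degree f + degree g"
  using length_mult(2)[of f g] assms unfolding monic_def
  by (cases f; cases g) auto

lemma degree_pow: assumes "monic f" shows "degree (f [^]\<^bsub>P\<^esub> (k::nat)) = k * degree f"
proof (induction k)
  case (Suc k)
  then show ?case using degree_mult[OF monic_pow[OF assms, of k] assms] by simp
qed (simp add: univ_poly_one)

lemma monic_degree_0: "monic f \<Longrightarrow> degree f = 0 \<longleftrightarrow> f = \<one>\<^bsub>P\<^esub>"
  unfolding monic_def univ_poly_one by (cases f) auto

lemma const_carrier: "c \<in> carrier R \<Longrightarrow> c \<noteq> \<zero> \<Longrightarrow> [c] \<in> carrier P"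
  by (simp add: poly_carrier_iff)

lemma make_monic:
  assumes "f \<in> carrier P" "f \<noteq> []"
  obtains g where "monic g" "f = [hd f] \<otimes>\<^bsub>P\<^esub> g" "length g = length f"
proof -
  have c: "hd f \<in> carrier R" "hd f \<noteq> \<zero>" using assms unfolding poly_carrier_iff by auto
  have ic: "inv (hd f) \<in> carrier R" "inv (hd f) \<noteq> \<zero>" "inv (hd f) \<otimes> hd f = \<one>"
    "hd f \<otimes> inv (hd f) = \<one>"
    using c field_Units by auto
  let ?g = "[inv (hd f)] \<otimes>\<^bsub>P\<^esub> f"
  have g: "?g \<noteq> []" "hd ?g = \<one>" "length ?g = length f" "?g \<in> carrier P"
    using length_mult[of "[inv (hd f)]" f] hd_mult[of "[inv (hd f)]" f] assms const_carrier[OF ic(1,2)] ic(3)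
    by auto
  have e: "[hd f] \<otimes>\<^bsub>P\<^esub> [inv (hd f)] = \<one>\<^bsub>P\<^esub>"
    using c ic(1,2,4) by (simp add: univ_poly_mult univ_poly_one)
  have "[hd f] \<otimes>\<^bsub>P\<^esub> ?g = ([hd f] \<otimes>\<^bsub>P\<^esub> [inv (hd f)]) \<otimes>\<^bsub>P\<^esub> f"
    by (rule UP.m_assoc[OF const_carrier[OF c] const_carrier[OF ic(1,2)] assms(1), symmetric])
  also have "\<dots> = f" unfolding e using assms(1) by (rule UP.l_one)
  finally have "[hd f] \<otimes>\<^bsub>P\<^esub> ?g = f" .
  then show ?thesis using that[of ?g] g unfolding monic_def by auto
qed

lemma units_iff: "f \<in> Units P \<longleftrightarrow> f \<in> carrier P \<and> f \<noteq> [] \<and> degree f = 0"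
  using univ_poly_units'[OF carrier_is_subfield] .

lemma mprime_carrier: "mprime p \<Longrightarrow> p \<in> carrier P"
  by (simp add: mprime_def monic_def)

lemma mprimeD: "mprime p \<Longrightarrow> x \<in> carrier P \<Longrightarrow> y \<in> carrier P \<Longrightarrow> p divides\<^bsub>P\<^esub> (x \<otimes>\<^bsub>P\<^esub> y) \<Longrightarrow>
  p divides\<^bsub>P\<^esub> x \<or> p divides\<^bsub>P\<^esub> y"
  by (auto simp: mprime_def ring_prime_def Divisibility.prime_def)

lemma mprime_irreducible: "mprime p \<Longrightarrow> ring_irreducible\<^bsub>P\<^esub> p"
  using UP.primeness_condition[of p] mprime_carrier[of p] unfolding mprime_def by simp

lemma mprime_degree: "mprime p \<Longrightarrow> degree p \<ge> 1"
  using pirreducible_degree[OF carrier_is_subfield mprime_carrier mprime_irreducible] .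

lemma exists_mprime_divisor:
  assumes "monic f" "degree f \<ge> 1"
  obtains p where "mprime p" "p divides\<^bsub>P\<^esub> f"
proof -
  have f: "f \<in> carrier P" "f \<noteq> []" using assms by (auto simp: monic_def)
  have "f \<notin> Units P" using units_iff[of f] assms(2) by auto
  then obtain b where b: "b \<in> carrier P" "ring_irreducible\<^bsub>P\<^esub> b" "b divides\<^bsub>P\<^esub> f"
    using UP.exists_irreducible_divisor[of f] f by (metis DiffI singletonD univ_poly_zero)
  have b0: "b \<noteq> []" using b(2) by (auto simp: ring_irreducible_def univ_poly_zero)
  obtain g where g: "monic g" "b = [hd b] \<otimes>\<^bsub>P\<^esub> g" using make_monic[OF b(1) b0] by metis
  have c: "hd b \<in> carrier R" "hd b \<noteq> \<zero>" using b(1) b0 unfolding poly_carrier_iff by auto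
  have gc: "g \<in> carrier P" using g by (simp add: monic_def)
  have u: "[hd b] \<in> Units P" using units_iff[of "[hd b]"] const_carrier[OF c] by simp
  have as: "b \<sim>\<^bsub>P\<^esub> g" using UP.ring_associated_iff[OF b(1) gc] u g(2) by blast
  have bp: "ring_prime\<^bsub>P\<^esub> b" using UP.primeness_condition[OF b(1)] b(2) by simp
  have gb: "g divides\<^bsub>P\<^esub> x \<longleftrightarrow> b divides\<^bsub>P\<^esub> x" if "x \<in> carrier P" for x
    using as b(1) gc that unfolding associated_def by (meson UP.divides_trans)
  have gu: "g \<notin> Units P"
    using bp g(2) u unfolding ring_prime_def Divisibility.prime_def by (metis UP.Units_m_closed)
  have "ring_prime\<^bsub>P\<^esub> g"
  proof (rule UP.ring_primeI)
    show "g \<noteq> \<zero>\<^bsub>P\<^esub>" using g(1) by (simp add: monic_def univ_poly_zero)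
    show "Divisibility.prime P g"
      using bp gb gu unfolding ring_prime_def Divisibility.prime_def by simp
  qed
  then show ?thesis using that[of g] g(1) gb[OF f(1)] b(3) unfolding mprime_def by simp
qed

lemma mprime_dvd_mprime:
  assumes "mprime p" "mprime r" "p divides\<^bsub>P\<^esub> r" shows "p = r"
proof -
  obtain c where c: "c \<in> carrier P" "r = p \<otimes>\<^bsub>P\<^esub> c" using assms(3) by (auto elim: dividesE)
  have pr: "p \<in> carrier P" "r \<in> carrier P" using assms mprime_carrier by auto
  have "p \<in> Units P \<or> c \<in> Units P"
    using UP.ring_irreducibleE(5)[OF pr(2) mprime_irreducible[OF assms(2)] pr(1) c(1) c(2)] .
  moreover have "p \<notin> Units P" using units_iff[of p] mprime_degree[OF assms(1)] by auto
  moreover have "monic c" using monic_cancel[of p c] assms c unfolding mprime_def by simp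
  ultimately have "c = \<one>\<^bsub>P\<^esub>" using units_iff[of c] monic_degree_0[of c] by simp
  then show ?thesis using c(2) pr by simp
qed


section \<open>Counting polynomials by length\<close>

lemma card_polys_le: "finite {f \<in> carrier P. length f \<le> n} \<and> card {f \<in> carrier P. length f \<le> n} = order R ^ n"
proof (induction n)
  case 0
  have "{f \<in> carrier P. length f \<le> 0} = {[]}" by (auto simp: poly_carrier_iff)
  then show ?case by simp
next
  case (Suc n)
  let ?L = "{xs. set xs \<subseteq> carrier R \<and> length xs = n}"
  let ?N = "(\<lambda>(a, xs). a # xs) ` ((carrier R - {\<zero>}) \<times> ?L)"
  have L: "finite ?L" "card ?L = order R ^ n"
    using fin by (auto simp: finite_lists_length_eq card_lists_length_eq order_def)
  have u: "{f \<in> carrier P. length f \<le> Suc n} = {f \<in> carrier P. length f \<le> n} \<union> ?N"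
  proof (intro equalityI subsetI)
    fix f assume "f \<in> {f \<in> carrier P. length f \<le> Suc n}"
    then show "f \<in> {f \<in> carrier P. length f \<le> n} \<union> ?N"
      by (cases f) (auto simp: poly_carrier_iff image_iff)
  next
    fix f assume "f \<in> {f \<in> carrier P. length f \<le> n} \<union> ?N"
    then show "f \<in> {f \<in> carrier P. length f \<le> Suc n}" by (auto simp: poly_carrier_iff)
  qed
  have N: "finite ?N" "card ?N = (order R - 1) * order R ^ n"
    using L fin by (auto simp: card_image inj_on_def card_cartesian_product order_def)
  have "card {f \<in> carrier P. length f \<le> Suc n} = order R ^ n + (order R - 1) * order R ^ n"
    unfolding u using Suc N by (subst card_Un_disjoint) auto
  also have "\<dots> = order R ^ Suc n" using order_gt_2 by (simp add: algebra_simps flip: power_Suc)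
  finally show ?case using u Suc N by simp
qed

lemma monic_polys_Cons: "monic_polys R n = (\<lambda>xs. \<one> # xs) ` {xs. set xs \<subseteq> carrier R \<and> length xs = n}"
proof (intro equalityI subsetI)
  fix f assume "f \<in> monic_polys R n"
  then show "f \<in> (\<lambda>xs. \<one> # xs) ` {xs. set xs \<subseteq> carrier R \<and> length xs = n}"
    unfolding monic_polys_eq by (cases f) (auto simp: monic_def poly_carrier_iff)
qed (auto simp: monic_polys_eq monic_def poly_carrier_iff)

lemma finite_monic_polys: "finite (monic_polys R n)"
  and card_monic_polys: "card (monic_polys R n) = order R ^ n"
  unfolding monic_polys_Cons using fin
  by (auto simp: finite_lists_length_eq card_lists_length_eq order_def card_image inj_on_def)

text \<open>The first summand has even degree and the second odd degree, so their leading terms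
  never cancel and the longer summand decides. If \<open>a = []\<close>, truncated subtraction makes
  the first bound 0, as it should be.\<close>

lemma sum_squares_lead:
  assumes "a \<in> carrier P" "b \<in> carrier P" "a \<noteq> [] \<or> b \<noteq> []"
  defines "f \<equiv> a \<otimes>\<^bsub>P\<^esub> a \<oplus>\<^bsub>P\<^esub> X \<otimes>\<^bsub>P\<^esub> (b \<otimes>\<^bsub>P\<^esub> b)"
  shows "f \<noteq> [] \<and> length f \<le> max (2 * length a - 1) (2 * length b) \<and>
    (\<exists>e\<in>carrier R. e \<noteq> \<zero> \<and> hd f = e \<otimes> e)"
proof -
  have X: "X \<noteq> []" "length X = 2" "hd X = \<one>" by (auto simp: var_def)
  have lead: "hd g \<in> carrier R" "hd g \<noteq> \<zero>" if "g \<in> carrier P" "g \<noteq> []" for g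
    using that unfolding poly_carrier_iff by auto
  let ?a = "a \<otimes>\<^bsub>P\<^esub> a" and ?b = "X \<otimes>\<^bsub>P\<^esub> (b \<otimes>\<^bsub>P\<^esub> b)"
  have a: "?a \<noteq> []" "length ?a = 2 * length a - 1" "hd ?a = hd a \<otimes> hd a" if "a \<noteq> []"
    using length_mult[of a a] hd_mult[of a a] assms(1) that by auto
  have b: "?b \<noteq> []" "length ?b = 2 * length b" "hd ?b = hd b \<otimes> hd b" if "b \<noteq> []"
    using length_mult[of b b] hd_mult[of b b] length_mult[of X "b \<otimes>\<^bsub>P\<^esub> b"] hd_mult[of X "b \<otimes>\<^bsub>P\<^esub> b"]
      assms(2) that X lead[of b] by auto
  have ac: "?a \<in> carrier P" "?b \<in> carrier P" using assms by auto
  show ?thesis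
  proof (cases "a = [] \<or> b = []")
    case True
    then show ?thesis
    proof
      assume e: "a = []"
      then have "f = ?b" unfolding f_def using ac assms(1,2)
        by (metis UP.l_null UP.l_zero univ_poly_zero)
      then show ?thesis using b lead[of b] assms(2,3) e by auto
    next
      assume e: "b = []"
      then have "f = ?a" unfolding f_def using ac assms(1,2)
        by (metis UP.r_null UP.r_zero X_carrier univ_poly_zero)
      then show ?thesis using a lead[of a] assms(1,3) e by auto
    qed
  next
    case False
    have lp: "length a > 0" "length b > 0" using False by auto
    consider "length ?b < length ?a" | "length ?a < length ?b"
      using a(2) b(2) False lp by (metis (no_types, lifting) Suc_1 Suc_diff_1 dvd_triv_left even_Suc linorder_neqE_nat nat_0_less_mult_iff pos2)
    then show ?thesis
    proof cases
      case 1
      then have "hd f = hd ?a" "length f = length ?a"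
        unfolding f_def using add_longer[OF ac] by auto
      then show ?thesis using a lead[of a] assms(1) False lp by (auto simp del: length_greater_0_conv simp flip: length_greater_0_conv)
    next
      case 2
      then have "hd f = hd ?b" "length f = length ?b"
        unfolding f_def UP.a_comm[OF ac] using add_longer[OF ac(2,1)] by auto
      then show ?thesis using b lead[of b] assms(2) False lp by (auto simp del: length_greater_0_conv simp flip: length_greater_0_conv)
    qed
  qed
qed

text \<open>Thue's argument: among the small pairs \<open>(a, b)\<close> two have the same \<open>aB - bA\<close> modulo \<open>p\<close>; their
  difference represents a nonzero multiple of \<open>p\<close> of degree at most \<open>deg p\<close>.\<close>

lemma qform_or_inert:
  assumes p: "mprime p"
  shows "UP.qform X p \<or> UP.inert X p"
proof (rule disjCI)
  assume "\<not> UP.inert X p"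
  then obtain A B where AB: "A \<in> carrier P" "B \<in> carrier P"
    "p divides\<^bsub>P\<^esub> (A \<otimes>\<^bsub>P\<^esub> A \<oplus>\<^bsub>P\<^esub> X \<otimes>\<^bsub>P\<^esub> (B \<otimes>\<^bsub>P\<^esub> B))" "\<not> p divides\<^bsub>P\<^esub> B"
    unfolding UP.inert_def by blast
  have pc: "p \<in> carrier P" "p \<noteq> []" using p by (auto simp: mprime_def monic_def)
  define d where "d = degree p"
  have d: "d \<ge> 1" "length p = d + 1" using mprime_degree[OF p] pc(2) unfolding d_def by (auto simp: Suc_diff_1)
  \<comment> \<open>The sizes balance two demands. The exponents add up to \<open>d + 1\<close>, one
    more than the exponent for residues modulo \<open>p\<close>; and \<open>2 * length a - 1\<close>
    and \<open>2 * length b\<close> are at most \<open>d + 1\<close>, the length of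
    \<open>p\<close>.\<close>
  define U where "U = {a \<in> carrier P. length a \<le> d div 2 + 1}"
  define V where "V = {b \<in> carrier P. length b \<le> (d - 1) div 2 + 1}"
  define W where "W = {f \<in> carrier P. length f \<le> d}"
  define \<phi> where "\<phi> = (\<lambda>(a, b). (a \<otimes>\<^bsub>P\<^esub> B \<ominus>\<^bsub>P\<^esub> b \<otimes>\<^bsub>P\<^esub> A) pmod p)"
  have UVW: "finite U" "card U = order R ^ (d div 2 + 1)" "finite V" "card V = order R ^ ((d - 1) div 2 + 1)"
    "finite W" "card W = order R ^ d"
    unfolding U_def V_def W_def using card_polys_le by auto
  have "card W < card (U \<times> V)"
  proof -
    have "d div 2 + 1 + ((d - 1) div 2 + 1) = d + 1" using d(1) by linarith
    then have c: "card (U \<times> V) = order R ^ (d + 1)"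
      unfolding card_cartesian_product UVW by (simp only: flip: power_add)
    show ?thesis unfolding c UVW(6) using order_gt_2 by simp
  qed
  moreover have "\<phi> ` (U \<times> V) \<subseteq> W"
  proof safe
    fix a b assume "a \<in> U" "b \<in> V"
    then have c: "a \<otimes>\<^bsub>P\<^esub> B \<ominus>\<^bsub>P\<^esub> b \<otimes>\<^bsub>P\<^esub> A \<in> carrier P" using AB unfolding U_def V_def by simp
    then show "\<phi> (a, b) \<in> W"
      using pmod_degree[OF carrier_is_subfield c pc] long_division_closed(2)[OF carrier_is_subfield c pc(1)] d(1)
      unfolding \<phi>_def W_def d_def by auto
  qed
  ultimately have "\<not> inj_on \<phi> (U \<times> V)"
    using card_inj_on_le[of \<phi> "U \<times> V" W] UVW(5) by auto
  then obtain a1 b1 a2 b2 where ab: "a1 \<in> U" "b1 \<in> V" "a2 \<in> U" "b2 \<in> V"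
    "\<phi> (a1, b1) = \<phi> (a2, b2)" "(a1, b1) \<noteq> (a2, b2)" unfolding inj_on_def by blast
  have abc: "a1 \<in> carrier P" "b1 \<in> carrier P" "a2 \<in> carrier P" "b2 \<in> carrier P"
    using ab unfolding U_def V_def by auto
  define a where "a = a1 \<ominus>\<^bsub>P\<^esub> a2"
  define b where "b = b1 \<ominus>\<^bsub>P\<^esub> b2"
  have abP: "a \<in> carrier P" "b \<in> carrier P" unfolding a_def b_def using abc by auto
  have "length a \<le> max (length a1) (length a2)" "length b \<le> max (length b1) (length b2)"
    unfolding a_def b_def by (rule length_minus_le[OF abc(3)], rule length_minus_le[OF abc(4)])
  moreover have "length a1 \<le> d div 2 + 1" "length a2 \<le> d div 2 + 1"
    "length b1 \<le> (d - 1) div 2 + 1" "length b2 \<le> (d - 1) div 2 + 1"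
    using ab(1-4) unfolding U_def V_def by auto
  ultimately have len: "length a \<le> d div 2 + 1" "length b \<le> (d - 1) div 2 + 1" by linarith+
  have nz: "a \<noteq> [] \<or> b \<noteq> []"
    using ab(6) UP.r_right_minus_eq[OF abc(1,3)] UP.r_right_minus_eq[OF abc(2,4)] unfolding a_def b_def univ_poly_zero by auto
  have "p divides\<^bsub>P\<^esub> ((a1 \<otimes>\<^bsub>P\<^esub> B \<ominus>\<^bsub>P\<^esub> b1 \<otimes>\<^bsub>P\<^esub> A) \<ominus>\<^bsub>P\<^esub> (a2 \<otimes>\<^bsub>P\<^esub> B \<ominus>\<^bsub>P\<^esub> b2 \<otimes>\<^bsub>P\<^esub> A))"
    using ab(5) same_pmod_iff_pdivides[OF carrier_is_subfield _ _ pc(1), of "a1 \<otimes>\<^bsub>P\<^esub> B \<ominus>\<^bsub>P\<^esub> b1 \<otimes>\<^bsub>P\<^esub> A" "a2 \<otimes>\<^bsub>P\<^esub> B \<ominus>\<^bsub>P\<^esub> b2 \<otimes>\<^bsub>P\<^esub> A"]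
      abc AB unfolding \<phi>_def pdivides_def by auto
  moreover have "(a1 \<otimes>\<^bsub>P\<^esub> B \<ominus>\<^bsub>P\<^esub> b1 \<otimes>\<^bsub>P\<^esub> A) \<ominus>\<^bsub>P\<^esub> (a2 \<otimes>\<^bsub>P\<^esub> B \<ominus>\<^bsub>P\<^esub> b2 \<otimes>\<^bsub>P\<^esub> A) = a \<otimes>\<^bsub>P\<^esub> B \<ominus>\<^bsub>P\<^esub> b \<otimes>\<^bsub>P\<^esub> A"
    unfolding a_def b_def using abc AB by algebra
  ultimately obtain u where u: "u \<in> carrier P" "a \<otimes>\<^bsub>P\<^esub> B \<ominus>\<^bsub>P\<^esub> b \<otimes>\<^bsub>P\<^esub> A = p \<otimes>\<^bsub>P\<^esub> u" by (auto elim: dividesE)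
  obtain v where v: "v \<in> carrier P" "A \<otimes>\<^bsub>P\<^esub> A \<oplus>\<^bsub>P\<^esub> X \<otimes>\<^bsub>P\<^esub> (B \<otimes>\<^bsub>P\<^esub> B) = p \<otimes>\<^bsub>P\<^esub> v" using AB(3) by (auto elim: dividesE)
  let ?f = "a \<otimes>\<^bsub>P\<^esub> a \<oplus>\<^bsub>P\<^esub> X \<otimes>\<^bsub>P\<^esub> (b \<otimes>\<^bsub>P\<^esub> b)"
  have fc: "?f \<in> carrier P" using abP by simp
  \<comment> \<open>As \<open>p\<close> does not divide \<open>B\<close>, it suffices to show that
    it divides \<open>B^2\<close> times the small value; there both \<open>aB - bA\<close> and
    \<open>A^2 + X B^2\<close> are multiples of \<open>p\<close>.\<close>
  have "B \<otimes>\<^bsub>P\<^esub> (B \<otimes>\<^bsub>P\<^esub> ?f) = (a \<otimes>\<^bsub>P\<^esub> B \<ominus>\<^bsub>P\<^esub> b \<otimes>\<^bsub>P\<^esub> A) \<otimes>\<^bsub>P\<^esub> (a \<otimes>\<^bsub>P\<^esub> B \<oplus>\<^bsub>P\<^esub> b \<otimes>\<^bsub>P\<^esub> A) \<oplus>\<^bsub>P\<^esub> b \<otimes>\<^bsub>P\<^esub> b \<otimes>\<^bsub>P\<^esub> (A \<otimes>\<^bsub>P\<^esub> A \<oplus>\<^bsub>P\<^esub> X \<otimes>\<^bsub>P\<^esub> (B \<otimes>\<^bsub>P\<^esub> B))"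
    using abP AB(1,2) X_carrier by algebra
  also have "\<dots> = p \<otimes>\<^bsub>P\<^esub> (u \<otimes>\<^bsub>P\<^esub> (a \<otimes>\<^bsub>P\<^esub> B \<oplus>\<^bsub>P\<^esub> b \<otimes>\<^bsub>P\<^esub> A) \<oplus>\<^bsub>P\<^esub> b \<otimes>\<^bsub>P\<^esub> b \<otimes>\<^bsub>P\<^esub> v)"
    unfolding u(2) v(2) using u(1) v(1) pc(1) abP AB(1,2) by algebra
  finally have "p divides\<^bsub>P\<^esub> (B \<otimes>\<^bsub>P\<^esub> (B \<otimes>\<^bsub>P\<^esub> ?f))"
    using dividesI[of "u \<otimes>\<^bsub>P\<^esub> (a \<otimes>\<^bsub>P\<^esub> B \<oplus>\<^bsub>P\<^esub> b \<otimes>\<^bsub>P\<^esub> A) \<oplus>\<^bsub>P\<^esub> b \<otimes>\<^bsub>P\<^esub> b \<otimes>\<^bsub>P\<^esub> v" P _ p] u(1) v(1) abP AB(1,2) by simp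
  then have "p divides\<^bsub>P\<^esub> ?f"
    using mprimeD[OF p AB(2)] AB(2,4) fc by (meson UP.m_closed)
  then obtain h where h: "h \<in> carrier P" "?f = p \<otimes>\<^bsub>P\<^esub> h" by (auto elim: dividesE)
  have lead: "?f \<noteq> []" "length ?f \<le> max (2 * length a - 1) (2 * length b)"
    and "\<exists>e\<in>carrier R. e \<noteq> \<zero> \<and> hd ?f = e \<otimes> e"
    using sum_squares_lead[OF abP nz] by auto
  then obtain e where e: "e \<in> carrier R" "e \<noteq> \<zero>" "hd ?f = e \<otimes> e" by blast
  have "length ?f \<le> length p" using lead(2) len d by linarith
  moreover have h0: "h \<noteq> []" using lead(1) h(2) pc(1) UP.r_null[of p] unfolding univ_poly_zero by auto
  ultimately have "length h \<le> 1" using length_mult(2)[OF pc(1) h(1) pc(2) h0] h(2) d(2) by auto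
  then obtain c where c: "h = [c]" using h0 by (cases h) auto
  have cR: "c \<in> carrier R" using h(1) c by (simp add: poly_carrier_iff)
  \<comment> \<open>Since \<open>p\<close> is monic, the constant cofactor \<open>c\<close> is the
    leading coefficient of the value, which is a square; dividing \<open>a\<close> and
    \<open>b\<close> by \<open>e\<close> then represents \<open>p\<close> itself.\<close>
  have "c = e \<otimes> e"
    using e(3) hd_mult[OF pc(1) h(1) pc(2) h0] h(2) c cR p unfolding mprime_def monic_def by simp
  then have hs: "h = [e] \<otimes>\<^bsub>P\<^esub> [e]" using e c by (simp add: univ_poly_mult integral_iff)
  define i where "i = [inv e]"
  have ie: "inv e \<in> carrier R" "inv e \<noteq> \<zero>" "inv e \<otimes> e = \<one>" using e(1,2) field_Units by auto
  have iP: "i \<in> carrier P" "[e] \<in> carrier P" unfolding i_def using ie e const_carrier by auto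
  have ie1: "i \<otimes>\<^bsub>P\<^esub> [e] = \<one>\<^bsub>P\<^esub>" unfolding i_def using ie e(1,2) by (simp add: univ_poly_mult univ_poly_one)
  have "p = (i \<otimes>\<^bsub>P\<^esub> [e]) \<otimes>\<^bsub>P\<^esub> (i \<otimes>\<^bsub>P\<^esub> [e]) \<otimes>\<^bsub>P\<^esub> p" unfolding ie1 using pc(1) by simp
  also have "\<dots> = i \<otimes>\<^bsub>P\<^esub> i \<otimes>\<^bsub>P\<^esub> (p \<otimes>\<^bsub>P\<^esub> ([e] \<otimes>\<^bsub>P\<^esub> [e]))" using iP pc(1) by algebra
  also have "\<dots> = i \<otimes>\<^bsub>P\<^esub> i \<otimes>\<^bsub>P\<^esub> ?f" using h(2) hs by simp
  also have "\<dots> = (i \<otimes>\<^bsub>P\<^esub> a) \<otimes>\<^bsub>P\<^esub> (i \<otimes>\<^bsub>P\<^esub> a) \<oplus>\<^bsub>P\<^esub> X \<otimes>\<^bsub>P\<^esub> ((i \<otimes>\<^bsub>P\<^esub> b) \<otimes>\<^bsub>P\<^esub> (i \<otimes>\<^bsub>P\<^esub> b))"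
    using iP(1) abP X_carrier by algebra
  finally show "UP.qform X p" unfolding UP.qform_def using iP(1) abP by blast
qed

end

section \<open>Reciprocity\<close>

lemma (in cring) finprod_signs:
  "finite A \<Longrightarrow> (\<Otimes>x\<in>A. if N x then \<ominus> \<one> else \<one>) = (if even (card {x \<in> A. N x}) then \<one> else \<ominus> \<one>)"
proof (induction A rule: finite_induct)
  case (insert x A)
  have e: "{y \<in> insert x A. N y} = (if N x then insert x {y \<in> A. N y} else {y \<in> A. N y})" by auto
  have m: "(\<ominus> \<one>) \<otimes> (\<ominus> \<one>) = \<one>" by algebra
  have c: "card {y \<in> insert x A. N y} = (if N x then Suc (card {y \<in> A. N y}) else card {y \<in> A. N y})"
    unfolding e using insert(1,2) by simp
  have "(\<Otimes>x\<in>insert x A. if N x then \<ominus> \<one> else \<one>) =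
    (if N x then \<ominus> \<one> else \<one>) \<otimes> (\<Otimes>x\<in>A. if N x then \<ominus> \<one> else \<one>)"
    by (rule finprod_insert) (use insert(1,2) in auto)
  then show ?case unfolding insert.IH c using m by (cases "N x") auto
qed simp

lemma (in domain) finprod_not_zero:
  "finite A \<Longrightarrow> f \<in> A \<rightarrow> carrier R - {\<zero>} \<Longrightarrow> finprod R f A \<in> carrier R - {\<zero>}"
proof (induction A rule: finite_induct)
  case (insert x A)
  then have f: "f \<in> A \<rightarrow> carrier R" "f x \<in> carrier R" "f x \<noteq> \<zero>" and "f \<in> A \<rightarrow> carrier R - {\<zero>}" by auto
  then have IH: "finprod R f A \<in> carrier R" "finprod R f A \<noteq> \<zero>" using insert.IH by auto
  have "finprod R f (insert x A) = f x \<otimes> finprod R f A"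
    by (rule finprod_insert) (use insert(1,2) f in auto)
  then show ?case using f(2,3) IH integral by auto
qed simp

context odd_finite_field
begin

lemma X_mult_Cons: "m \<in> carrier P \<Longrightarrow> m \<noteq> [] \<Longrightarrow> X \<otimes>\<^bsub>P\<^esub> m = m @ [\<zero>]"
  using UP.m_comm[OF X_carrier, of m] poly_mult_var[OF carrier_is_subring, of m] by metis

lemma const_term_last: "f \<in> carrier P \<Longrightarrow> f \<noteq> [] \<Longrightarrow> const_term f = last f"
  using const_term_eq_last unfolding poly_carrier_iff by (cases f rule: rev_cases) auto

text \<open>Evaluation at \<open>T = 0\<close> leaves only the square of \<open>A(0)\<close>. This
  is the easy half of reciprocity.\<close>

lemma const_term_sum_squares:
  assumes "UP.qform X f" "const_term f \<noteq> \<zero>" shows "qchar (const_term f) = 1"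
proof -
  note ct = const_term_simprules_shell[OF carrier_is_subring]
  obtain A B where AB: "A \<in> carrier P" "B \<in> carrier P"
    "f = A \<otimes>\<^bsub>P\<^esub> A \<oplus>\<^bsub>P\<^esub> X \<otimes>\<^bsub>P\<^esub> (B \<otimes>\<^bsub>P\<^esub> B)"
    using assms unfolding UP.qform_def by blast
  have "const_term X = \<zero>" using eval_var[OF zero_closed] by (simp add: const_term_def)
  then have "const_term f = const_term A \<otimes> const_term A"
    using AB(1,2) unfolding AB(3) by (simp add: ct)
  then show ?thesis using qchar_square[of "const_term A"] ct(1)[OF AB(1)] assms(2) by (auto simp: integral_iff)
qed

text \<open>The count \<open>(q^d - 1) / (q - 1)\<close> is the index of the constants in the unit
  group of a residue field of degree \<open>d\<close>; it makes the exponents in Gauss's lemma match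
  Euler's criterion there.\<close>

lemma card_monic_length_le: "card {m. monic m \<and> length m \<le> d} * (order R - 1) = order R ^ d - 1"
proof (induction d)
  case 0
  have "{m. monic m \<and> length m \<le> 0} = {}" by (auto simp: monic_def)
  then show ?case by simp
next
  case (Suc d)
  have deg: "length m = Suc (degree m)" if "monic m" for m using that by (auto simp: monic_def)
  have u: "{m. monic m \<and> length m \<le> Suc d} = {m. monic m \<and> length m \<le> d} \<union> monic_polys R d"
    unfolding monic_polys_eq using deg by fastforce
  have f: "finite {m. monic m \<and> length m \<le> d}"
    using card_polys_le[of d] by (rule_tac finite_subset[of _ "{f \<in> carrier P. length f \<le> d}"]) (auto simp: monic_def)
  have "{m. monic m \<and> length m \<le> d} \<inter> monic_polys R d = {}"
    unfolding monic_polys_eq using deg by fastforce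
  then have c: "card {m. monic m \<and> length m \<le> Suc d} = card {m. monic m \<and> length m \<le> d} + order R ^ d"
    unfolding u using f finite_monic_polys by (simp add: card_Un_disjoint card_monic_polys)
  have "order R ^ d \<ge> 1" using order_gt_2 by simp
  then show ?case using Suc.IH order_gt_2 unfolding c by (simp add: algebra_simps)
qed

text \<open>The normalisation factor in Gauss's lemma below: \<open>- T * m \<equiv> c * m'\<close> modulo \<open>p\<close> for a unique
  monic \<open>m\<close> of degree less than \<open>deg p\<close>, where \<open>c\<close> only depends on the last coefficient of \<open>m'\<close>.\<close>

definition gauss_factor :: "'a \<Rightarrow> 'a \<Rightarrow> 'a" where
  "gauss_factor c0 a = (if a = \<zero> then \<ominus> \<one> else c0 \<otimes> inv a)"

lemma gauss_factor_unit:
  assumes "c0 \<in> carrier R" "c0 \<noteq> \<zero>" "a \<in> carrier R"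
  shows "gauss_factor c0 a \<in> carrier R" "gauss_factor c0 a \<noteq> \<zero>"
  using assms field_Units by (auto simp: gauss_factor_def integral_iff)

text \<open>One must reach a multiple of \<open>T\<close> before dividing by it. If
  \<open>m'\<close> ends in 0, it is one already, and the sign of \<open>- T\<close> gives the
  factor -1. Otherwise \<open>p - c m'\<close> has constant term 0 for
  \<open>c = p(0) / m'(0)\<close>, and it stays monic because \<open>m'\<close> is shorter than
  \<open>p\<close>.\<close>

lemma gauss_step:
  assumes p: "mprime p" "const_term p \<noteq> \<zero>" and m': "monic m'" "length m' < length p"
  shows "\<exists>m. monic m \<and> length m < length p \<and> (\<exists>u\<in>carrier P.
    (\<ominus>\<^bsub>P\<^esub> X) \<otimes>\<^bsub>P\<^esub> m = [gauss_factor (const_term p) (last m')] \<otimes>\<^bsub>P\<^esub> m' \<ominus>\<^bsub>P\<^esub> p \<otimes>\<^bsub>P\<^esub> u)"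
proof -
  note ct = const_term_simprules_shell[OF carrier_is_subring]
  have pc: "p \<in> carrier P" "p \<noteq> []" "hd p = \<one>" using p by (auto simp: mprime_def monic_def)
  have mc: "m' \<in> carrier P" "m' \<noteq> []" "hd m' = \<one>" using m' by (auto simp: monic_def)
  have c0: "const_term p \<in> carrier R" using ct(1) pc by blast
  have la: "last m' \<in> carrier R" using mc unfolding poly_carrier_iff by auto
  let ?c = "gauss_factor (const_term p) (last m')"
  have cc: "?c \<in> carrier R" "?c \<noteq> \<zero>" using gauss_factor_unit[OF c0 p(2) la] by auto
  have shape: "\<exists>m. monic m \<and> g = X \<otimes>\<^bsub>P\<^esub> m \<and> length g = Suc (length m)"
    if g: "monic g" "const_term g = \<zero>" for g
  proof -
    have gp: "polynomial (carrier R) g" "g \<noteq> []" using g(1) univ_poly_carrier unfolding monic_def by auto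
    obtain m where m: "polynomial (carrier R) m" "m \<noteq> []" "g = m @ [\<zero>]"
      using const_term_zero[OF carrier_is_subring gp g(2)] by blast
    then have "m \<in> carrier P" by (simp add: univ_poly_carrier)
    then show ?thesis using m g(1) X_mult_Cons by (intro exI[of _ m]) (auto simp: monic_def)
  qed
  show ?thesis
  proof (cases "last m' = \<zero>")
    case True
    then obtain m where m: "monic m" "m' = X \<otimes>\<^bsub>P\<^esub> m" "length m' = Suc (length m)"
      using shape[OF m'(1)] const_term_last[OF mc(1,2)] by auto
    have "[?c] = \<ominus>\<^bsub>P\<^esub> \<one>\<^bsub>P\<^esub>"
      using True univ_poly_a_inv_def'[OF carrier_is_subring UP.one_closed] by (simp add: gauss_factor_def univ_poly_one)
    then have "(\<ominus>\<^bsub>P\<^esub> X) \<otimes>\<^bsub>P\<^esub> m = [?c] \<otimes>\<^bsub>P\<^esub> m' \<ominus>\<^bsub>P\<^esub> p \<otimes>\<^bsub>P\<^esub> \<zero>\<^bsub>P\<^esub>"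
      using m(1) pc(1) X_carrier unfolding m(2) monic_def by (simp add: UP.l_minus UP.minus_eq)
    then show ?thesis using m m'(2) by (intro exI[of _ m]) auto
  next
    case False
    have C: "[?c] \<in> carrier P" using const_carrier cc by simp
    let ?h = "[?c] \<otimes>\<^bsub>P\<^esub> m'"
    let ?g = "p \<ominus>\<^bsub>P\<^esub> ?h"
    have h: "?h \<in> carrier P" "length ?h = length m'" using C mc length_mult(2)[OF C mc(1)] by auto
    have nh: "\<ominus>\<^bsub>P\<^esub> ?h \<in> carrier P" "length (\<ominus>\<^bsub>P\<^esub> ?h) < length p"
      using h univ_poly_a_inv_length[OF carrier_is_subring h(1)] m'(2) by auto
    have g: "hd ?g = \<one>" "length ?g = length p" "?g \<in> carrier P"
      using add_longer[OF pc(1) nh] pc h(1) unfolding a_minus_def by auto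
    then have gm: "monic ?g" using pc(2) unfolding monic_def by auto
    have "const_term [?c] = ?c" using cc const_term_last[OF C] by simp
    then have "const_term ?h = (const_term p \<otimes> inv (last m')) \<otimes> last m'"
      using ct(2)[OF C mc(1)] const_term_last[OF mc(1,2)] False by (simp add: gauss_factor_def)
    also have "\<dots> = const_term p" using False la c0 field_Units by (simp add: m_assoc)
    finally have "const_term ?g = \<zero>"
      unfolding a_minus_def using ct(3)[OF pc(1) nh(1)] ct(4)[OF h(1)] c0 by (simp add: r_neg)
    then obtain m where m: "monic m" "?g = X \<otimes>\<^bsub>P\<^esub> m" "length ?g = Suc (length m)"
      using shape[OF gm] by auto
    have mP: "m \<in> carrier P" using m(1) by (simp add: monic_def)
    have "(\<ominus>\<^bsub>P\<^esub> X) \<otimes>\<^bsub>P\<^esub> m = \<ominus>\<^bsub>P\<^esub> ?g" unfolding m(2) using mP X_carrier by (simp add: UP.l_minus)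
    also have "\<dots> = ?h \<ominus>\<^bsub>P\<^esub> p \<otimes>\<^bsub>P\<^esub> \<one>\<^bsub>P\<^esub>" using h(1) pc(1) by algebra
    finally show ?thesis using m g(2) by (intro exI[of _ m]) auto
  qed
qed

text \<open>The condition only concerns the last coefficient \<open>a\<close>, so the count is a
  product. For \<open>a\<close> nonzero the factor is a nonsquare iff \<open>a\<close> is, which
  happens \<open>half\<close> times; for \<open>a = 0\<close> the factor is -1, a nonsquare iff
  \<open>half\<close> is odd. The total, \<open>half\<close> plus its parity, is even.\<close>

lemma even_card_gauss:
  assumes c0: "c0 \<in> carrier R" "qchar c0 = 1"
  shows "even (card {m. monic m \<and> length m \<le> d \<and> qchar (gauss_factor c0 (last m)) = - 1})"
proof -
  let ?E = "{a \<in> carrier R. qchar (gauss_factor c0 a) = - 1}"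
  let ?M = "{m. monic m \<and> length m < d}"
  have q: "qchar (gauss_factor c0 a) = qchar a" if "a \<in> carrier R" "a \<noteq> \<zero>" for a
  proof -
    have i: "inv a \<in> carrier R" "inv a \<otimes> a = \<one>" using that field_Units by auto
    have "qchar (inv a) * qchar a = 1" using qchar_mult[OF i(1) that(1)] i(2) by simp
    then have "qchar (inv a) = qchar a" using qchar_cases[OF that(2)] by auto
    then show ?thesis using that i(1) qchar_mult[OF c0(1) i(1)] c0(2) by (simp add: gauss_factor_def)
  qed
  have "?E = {a \<in> carrier R. qchar a = -1} \<union> (if odd half then {\<zero>} else {})"
    using q by (auto simp: gauss_factor_def qchar_minus_one split: if_splits)
  then have "card ?E = half + (if odd half then 1 else 0)"
    using card_nonsquares fin by (auto simp: card_insert_if)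
  then have E: "even (card ?E)" by auto
  have "{m. monic m \<and> length m \<le> d \<and> qchar (gauss_factor c0 (last m)) = - 1} = (\<lambda>(m, a). m @ [a]) ` (?M \<times> ?E)"
  proof (intro equalityI subsetI)
    fix m assume m: "m \<in> {m. monic m \<and> length m \<le> d \<and> qchar (gauss_factor c0 (last m)) = - 1}"
    then obtain n a where na: "m = n @ [a]" by (cases m rule: rev_cases) (auto simp: monic_def)
    \<comment> \<open>The constant polynomial 1 is its own last coefficient; its factor is
      \<open>c0\<close>, a square, so it is not counted and every counted \<open>m\<close> has a
      monic prefix.\<close>
    have "n \<noteq> []"
      using m c0 na by (auto simp: monic_def gauss_factor_def)
    then have "monic n \<and> length n < d \<and> a \<in> ?E" using m na by (auto simp: monic_def poly_carrier_iff)
    then show "m \<in> (\<lambda>(m, a). m @ [a]) ` (?M \<times> ?E)" using na by auto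
  next
    fix m assume "m \<in> (\<lambda>(m, a). m @ [a]) ` (?M \<times> ?E)"
    then show "m \<in> {m. monic m \<and> length m \<le> d \<and> qchar (gauss_factor c0 (last m)) = - 1}"
      by (auto simp: monic_def poly_carrier_iff)
  qed
  moreover have "inj_on (\<lambda>(m, a). m @ [a]) (?M \<times> ?E)" by (auto simp: inj_on_def)
  ultimately have "card {m. monic m \<and> length m \<le> d \<and> qchar (gauss_factor c0 (last m)) = - 1} = card ?M * card ?E"
    by (simp add: card_image card_cartesian_product)
  then show ?thesis using E by simp
qed

end

lemma (in domain) nat_pow_not_zero:
  "x \<in> carrier R \<Longrightarrow> x \<noteq> \<zero> \<Longrightarrow> x [^] (n::nat) \<noteq> \<zero>"
  by (induction n) (auto dest: integral)

context odd_finite_field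
begin

text \<open>Gauss's lemma with monic polynomials as representatives of the nonzero residues modulo
  constants: \<open>- T\<close> permutes them up to the factors counted in the previous lemma, so their product
  shows that \<open>- T\<close> satisfies Euler's criterion modulo \<open>p\<close>.\<close>

lemma minus_X_square:
  assumes p: "mprime p" "qchar (const_term p) = 1"
  shows "\<exists>C\<in>carrier P. p divides\<^bsub>P\<^esub> (C \<otimes>\<^bsub>P\<^esub> C \<oplus>\<^bsub>P\<^esub> X)"
proof -
  have pc: "p \<in> carrier P" "p \<noteq> []" "hd p = \<one>" using p by (auto simp: mprime_def monic_def)
  define d where "d = degree p"
  have d: "length p = Suc d" using pc(2) unfolding d_def by auto
  let ?K = "Rupt (carrier R) p"
  define \<phi> where "\<phi> = rupture_surj (carrier R) p"
  interpret h: ring_hom_ring P ?K \<phi>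
    unfolding \<phi>_def using rupture_surj_hom(2)[OF carrier_is_subring pc(1)] .
  \<comment> \<open>The polynomials of length at most \<open>d\<close> are their own remainders:
    they form a system of representatives, which gives the order of the residue field and the
    injectivity used below.\<close>
  have pmod_img: "(\<lambda>f. f pmod p) ` carrier P = {f \<in> carrier P. length f \<le> d}"
  proof (intro equalityI subsetI)
    fix f assume "f \<in> (\<lambda>f. f pmod p) ` carrier P"
    then obtain g where g: "g \<in> carrier P" "f = g pmod p" by auto
    then show "f \<in> {f \<in> carrier P. length f \<le> d}"
      using pmod_degree[OF carrier_is_subfield g(1) pc(1,2)]
        long_division_closed(2)[OF carrier_is_subfield g(1) pc(1)] unfolding d_def by auto
  next
    fix f assume f: "f \<in> {f \<in> carrier P. length f \<le> d}"
    have "f pmod p = f"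
    proof (cases "f = []")
      case True then show ?thesis using long_division_zero(2)[OF carrier_is_subfield pc(1)] by simp
    next
      case False
      then have "degree f < degree p" using f d by (cases f) auto
      then show ?thesis using pmod_const(2)[OF carrier_is_subfield _ pc(1)] f by auto
    qed
    then show "f \<in> (\<lambda>f. f pmod p) ` carrier P" using f by (metis (mono_tags, lifting) image_eqI mem_Collect_eq)
  qed
  have img: "\<phi> ` {f \<in> carrier P. length f \<le> d} = carrier ?K"
    using rupture_carrier_as_pmod_image[OF carrier_is_subfield pc(1)] unfolding \<phi>_def pmod_img .
  have inj: "inj_on \<phi> {f \<in> carrier P. length f \<le> d}"
    using rupture_surj_inj_on[OF carrier_is_subfield pc(1)] unfolding \<phi>_def pmod_img .
  have finK: "finite (carrier ?K)" unfolding img[symmetric] using card_polys_le[of d] by blast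
  have ordK: "order ?K = order R ^ d"
    unfolding order_def[of ?K] img[symmetric] card_image[OF inj] using card_polys_le[of d] by blast
  interpret K: odd_finite_field ?K
  proof (intro odd_finite_field.intro odd_finite_field_axioms.intro)
    show "field ?K" using rupture_is_field_iff_pirreducible[OF carrier_is_subfield pc(1)]
      mprime_irreducible[OF p(1)] by simp
    show "finite (carrier ?K)" by (rule finK)
    show "odd (order ?K)" unfolding ordK using odd_order by simp
  qed
  have phi_zero: "\<phi> f = \<zero>\<^bsub>?K\<^esub> \<longleftrightarrow> p divides\<^bsub>P\<^esub> f" if f: "f \<in> carrier P" for f
  proof -
    have "\<phi> f = \<phi> (f pmod p)" unfolding \<phi>_def using rupture_surj_composed_with_pmod[OF carrier_is_subfield pc(1) f] .
    moreover have "f pmod p \<in> {f \<in> carrier P. length f \<le> d}" using f pmod_img by blast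
    moreover have "[] \<in> {f \<in> carrier P. length f \<le> d}" by (auto simp: poly_carrier_iff)
    moreover have "\<phi> [] = \<zero>\<^bsub>?K\<^esub>" using h.hom_zero unfolding univ_poly_zero .
    ultimately have "\<phi> f = \<zero>\<^bsub>?K\<^esub> \<longleftrightarrow> f pmod p = []"
      using inj_on_eq_iff[OF inj, of "f pmod p" "[]"] by simp
    then show ?thesis using pmod_zero_iff_pdivides[OF carrier_is_subfield f pc(1)] unfolding pdivides_def by simp
  qed
  have phi_p: "\<phi> p = \<zero>\<^bsub>?K\<^esub>" using phi_zero[OF pc(1)] pc(1) by simp

  define M where "M = {m. monic m \<and> length m \<le> d}"
  have M_sub: "M \<subseteq> {f \<in> carrier P. length f \<le> d}" unfolding M_def by (auto simp: monic_def)
  have finM: "finite M" using card_polys_le[of d] M_sub finite_subset by blast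
  have MP: "m \<in> carrier P" if "m \<in> M" for m using that M_sub by blast
  define c where "c m = gauss_factor (const_term p) (last m)" for m
  have c0: "const_term p \<in> carrier R" "const_term p \<noteq> \<zero>"
    using const_term_simprules_shell(1)[OF carrier_is_subring pc(1)] p(2) by auto
  have c: "c m \<in> carrier R" "c m \<noteq> \<zero>" "[c m] \<in> carrier P" if "m \<in> M" for m
  proof -
    have "last m \<in> carrier R" using that M_def by (auto simp: monic_def poly_carrier_iff)
    then show "c m \<in> carrier R" "c m \<noteq> \<zero>" using gauss_factor_unit[OF c0] unfolding c_def by auto
    then show "[c m] \<in> carrier P" by (rule const_carrier)
  qed
  let ?y = "\<phi> (\<ominus>\<^bsub>P\<^esub> X)"
  have y: "?y \<in> carrier ?K" by simp
  have "\<forall>m'\<in>M. \<exists>m. m \<in> M \<and> ?y \<otimes>\<^bsub>?K\<^esub> \<phi> m = \<phi> [c m'] \<otimes>\<^bsub>?K\<^esub> \<phi> m'"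
  proof
    fix m' assume m': "m' \<in> M"
    then have "monic m'" "length m' < length p" unfolding M_def d by auto
    then obtain m u where m: "monic m" "length m < length p" "u \<in> carrier P"
      "(\<ominus>\<^bsub>P\<^esub> X) \<otimes>\<^bsub>P\<^esub> m = [c m'] \<otimes>\<^bsub>P\<^esub> m' \<ominus>\<^bsub>P\<^esub> p \<otimes>\<^bsub>P\<^esub> u"
      using gauss_step[OF p(1) c0(2)] unfolding c_def by blast
    have mM: "m \<in> M" using m unfolding M_def d by simp
    have "?y \<otimes>\<^bsub>?K\<^esub> \<phi> m = \<phi> ((\<ominus>\<^bsub>P\<^esub> X) \<otimes>\<^bsub>P\<^esub> m)" using MP[OF mM] by (simp del: h.hom_a_inv)
    also have "\<dots> = \<phi> [c m'] \<otimes>\<^bsub>?K\<^esub> \<phi> m'"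
      unfolding m(4) using c(3)[OF m'] MP[OF m'] pc(1) m(3) phi_p by (simp add: a_minus_def)
    finally show "\<exists>m. m \<in> M \<and> ?y \<otimes>\<^bsub>?K\<^esub> \<phi> m = \<phi> [c m'] \<otimes>\<^bsub>?K\<^esub> \<phi> m'" using mM by blast
  qed
  then obtain \<tau> where \<tau>: "\<And>m. m \<in> M \<Longrightarrow> \<tau> m \<in> M"
    "\<And>m. m \<in> M \<Longrightarrow> ?y \<otimes>\<^bsub>?K\<^esub> \<phi> (\<tau> m) = \<phi> [c m] \<otimes>\<^bsub>?K\<^esub> \<phi> m" by (metis bchoice)
  \<comment> \<open>If two images agree, then \<open>c m * m\<close> and \<open>c n * n\<close> are
    congruent, and equal because both are short. As \<open>m\<close> and \<open>n\<close> are monic,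
    comparing leading coefficients gives \<open>c m = c n\<close>, and the constant cancels.\<close>
  have inj_\<tau>: "inj_on \<tau> M"
  proof (rule inj_onI)
    fix m n assume mn: "m \<in> M" "n \<in> M" "\<tau> m = \<tau> n"
    have ln: "[c k] \<otimes>\<^bsub>P\<^esub> k \<in> {f \<in> carrier P. length f \<le> d} \<and> hd ([c k] \<otimes>\<^bsub>P\<^esub> k) = c k" if "k \<in> M" for k
      using that c[OF that] MP[OF that] length_mult(2)[of "[c k]" k] hd_mult[of "[c k]" k] unfolding M_def monic_def by auto
    have "\<phi> ([c m] \<otimes>\<^bsub>P\<^esub> m) = \<phi> ([c n] \<otimes>\<^bsub>P\<^esub> n)"
      using \<tau>(2)[OF mn(1)] \<tau>(2)[OF mn(2)] mn(3) c(3) MP mn(1,2) by simp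
    then have e: "[c m] \<otimes>\<^bsub>P\<^esub> m = [c n] \<otimes>\<^bsub>P\<^esub> n" using inj ln mn(1,2) unfolding inj_on_def by blast
    then have "c m = c n" using ln mn(1,2) by metis
    then have e': "[c m] \<otimes>\<^bsub>P\<^esub> m = [c m] \<otimes>\<^bsub>P\<^esub> n" using e by simp
    have "[c m] \<noteq> \<zero>\<^bsub>P\<^esub>" by (simp add: univ_poly_zero)
    then show "m = n" using UP.m_lcancel[OF _ c(3)[OF mn(1)] MP[OF mn(1)] MP[OF mn(2)]] e' by blast
  qed
  have \<tau>M: "\<tau> ` M = M" by (rule endo_inj_surj[OF finM _ inj_\<tau>]) (use \<tau> in auto)

  \<comment> \<open>Raising every factor to the power \<open>half\<close> turns each constant
    \<open>c m\<close> into its quadratic character, so only a sign per \<open>m\<close>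
    remains.\<close>
  let ?Q = "\<Otimes>\<^bsub>?K\<^esub>m\<in>M. \<phi> m [^]\<^bsub>?K\<^esub> half"
  have phi_cl: "\<phi> m \<in> carrier ?K" if "m \<in> M" for m using MP[OF that] by simp
  have phi_nz: "\<phi> m \<noteq> \<zero>\<^bsub>?K\<^esub>" if "m \<in> M" for m
  proof -
    have "\<not> p divides\<^bsub>P\<^esub> m"
      using pdivides_imp_degree_le[OF carrier_is_subring pc(1) MP[OF that]] that d mprime_degree[OF p(1)]
      unfolding pdivides_def M_def monic_def by (cases m) auto
    then show ?thesis using phi_zero[OF MP[OF that]] by simp
  qed
  have Q: "?Q \<in> carrier ?K" "?Q \<noteq> \<zero>\<^bsub>?K\<^esub>"
    using K.finprod_not_zero[OF finM, of "\<lambda>m. \<phi> m [^]\<^bsub>?K\<^esub> half"] phi_cl phi_nz K.nat_pow_not_zero by auto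
  have sgn: "\<phi> [c m] [^]\<^bsub>?K\<^esub> half = (if qchar (c m) = - 1 then \<ominus>\<^bsub>?K\<^esub> \<one>\<^bsub>?K\<^esub> else \<one>\<^bsub>?K\<^esub>)" if "m \<in> M" for m
  proof -
    have pw: "[c m] [^]\<^bsub>P\<^esub> n = [c m [^] n]" for n :: nat
      using c[OF that] nat_pow_not_zero[OF c(1,2)[OF that]]
      by (induction n) (auto simp: univ_poly_one univ_poly_mult integral_iff)
    have "[\<ominus> \<one>] = \<ominus>\<^bsub>P\<^esub> \<one>\<^bsub>P\<^esub>"
      using univ_poly_a_inv_def'[OF carrier_is_subring UP.one_closed] by (simp add: univ_poly_one)
    then have m1: "\<phi> [\<ominus> \<one>] = \<ominus>\<^bsub>?K\<^esub> \<one>\<^bsub>?K\<^esub>" by simp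
    have p1: "\<phi> [\<one>] = \<one>\<^bsub>?K\<^esub>" using h.hom_one unfolding univ_poly_one .
    have "\<phi> [c m] [^]\<^bsub>?K\<^esub> n = \<phi> ([c m] [^]\<^bsub>P\<^esub> n)" for n :: nat
      using c(3)[OF that] by (induction n) simp_all
    then have "\<phi> [c m] [^]\<^bsub>?K\<^esub> half = \<phi> ([c m] [^]\<^bsub>P\<^esub> half)" .
    also have "\<dots> = \<phi> [c m [^] half]" using pw by simp
    also have "\<dots> = (if qchar (c m) = - 1 then \<ominus>\<^bsub>?K\<^esub> \<one>\<^bsub>?K\<^esub> else \<one>\<^bsub>?K\<^esub>)"
      using pow_half[OF c(1,2)[OF that]] c(2)[OF that] m1 p1 minus_one_neq_one by (auto simp: qchar_def)
    finally show ?thesis .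
  qed
  have "(?y [^]\<^bsub>?K\<^esub> half) [^]\<^bsub>?K\<^esub> card M \<otimes>\<^bsub>?K\<^esub> ?Q = (\<Otimes>\<^bsub>?K\<^esub>m\<in>M. ?y [^]\<^bsub>?K\<^esub> half) \<otimes>\<^bsub>?K\<^esub> (\<Otimes>\<^bsub>?K\<^esub>m\<in>\<tau> ` M. \<phi> m [^]\<^bsub>?K\<^esub> half)"
    unfolding \<tau>M by (subst K.finprod_const) simp_all
  also have "(\<Otimes>\<^bsub>?K\<^esub>m\<in>\<tau> ` M. \<phi> m [^]\<^bsub>?K\<^esub> half) = (\<Otimes>\<^bsub>?K\<^esub>m\<in>M. \<phi> (\<tau> m) [^]\<^bsub>?K\<^esub> half)"
    by (rule K.finprod_reindex) (use phi_cl \<tau>M inj_\<tau> in auto)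
  also have "(\<Otimes>\<^bsub>?K\<^esub>m\<in>M. ?y [^]\<^bsub>?K\<^esub> half) \<otimes>\<^bsub>?K\<^esub> \<dots> = (\<Otimes>\<^bsub>?K\<^esub>m\<in>M. ?y [^]\<^bsub>?K\<^esub> half \<otimes>\<^bsub>?K\<^esub> \<phi> (\<tau> m) [^]\<^bsub>?K\<^esub> half)"
    by (rule K.finprod_multf[symmetric]) (use phi_cl \<tau>(1) in auto)
  also have "\<dots> = (\<Otimes>\<^bsub>?K\<^esub>m\<in>M. (if qchar (c m) = - 1 then \<ominus>\<^bsub>?K\<^esub> \<one>\<^bsub>?K\<^esub> else \<one>\<^bsub>?K\<^esub>) \<otimes>\<^bsub>?K\<^esub> \<phi> m [^]\<^bsub>?K\<^esub> half)"
  proof (rule K.finprod_cong')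
    fix m assume m: "m \<in> M"
    have "?y [^]\<^bsub>?K\<^esub> half \<otimes>\<^bsub>?K\<^esub> \<phi> (\<tau> m) [^]\<^bsub>?K\<^esub> half = (?y \<otimes>\<^bsub>?K\<^esub> \<phi> (\<tau> m)) [^]\<^bsub>?K\<^esub> half"
      using K.nat_pow_distrib[OF y phi_cl[OF \<tau>(1)[OF m]]] by simp
    also have "\<dots> = \<phi> [c m] [^]\<^bsub>?K\<^esub> half \<otimes>\<^bsub>?K\<^esub> \<phi> m [^]\<^bsub>?K\<^esub> half"
      unfolding \<tau>(2)[OF m] using K.nat_pow_distrib[OF h.hom_closed[OF c(3)[OF m]] phi_cl[OF m]] by simp
    finally show "?y [^]\<^bsub>?K\<^esub> half \<otimes>\<^bsub>?K\<^esub> \<phi> (\<tau> m) [^]\<^bsub>?K\<^esub> half =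
      (if qchar (c m) = - 1 then \<ominus>\<^bsub>?K\<^esub> \<one>\<^bsub>?K\<^esub> else \<one>\<^bsub>?K\<^esub>) \<otimes>\<^bsub>?K\<^esub> \<phi> m [^]\<^bsub>?K\<^esub> half"
      unfolding sgn[OF m] .
  qed (use phi_cl in auto)
  also have "\<dots> = (\<Otimes>\<^bsub>?K\<^esub>m\<in>M. if qchar (c m) = - 1 then \<ominus>\<^bsub>?K\<^esub> \<one>\<^bsub>?K\<^esub> else \<one>\<^bsub>?K\<^esub>) \<otimes>\<^bsub>?K\<^esub> ?Q"
    by (rule K.finprod_multf) (use phi_cl in auto)
  also have "(\<Otimes>\<^bsub>?K\<^esub>m\<in>M. if qchar (c m) = - 1 then \<ominus>\<^bsub>?K\<^esub> \<one>\<^bsub>?K\<^esub> else \<one>\<^bsub>?K\<^esub>) = \<one>\<^bsub>?K\<^esub>"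
  proof -
    have "{m \<in> M. qchar (c m) = - 1} = {m. monic m \<and> length m \<le> d \<and> qchar (gauss_factor (const_term p) (last m)) = - 1}"
      unfolding M_def c_def by auto
    then have "even (card {m \<in> M. qchar (c m) = - 1})" using even_card_gauss[OF c0(1) p(2)] by simp
    then show ?thesis unfolding K.finprod_signs[OF finM] by simp
  qed
  finally have "(?y [^]\<^bsub>?K\<^esub> half) [^]\<^bsub>?K\<^esub> card M = \<one>\<^bsub>?K\<^esub>"
    using K.m_rcancel[OF Q(2,1), of "(?y [^]\<^bsub>?K\<^esub> half) [^]\<^bsub>?K\<^esub> card M" "\<one>\<^bsub>?K\<^esub>"] by simp
  \<comment> \<open>Numerically \<open>(q - 1)/2 * (q^d - 1)/(q - 1) = (q^d - 1)/2\<close>, the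
    exponent of Euler's criterion in the residue field.\<close>
  moreover have "half * card M = K.half"
  proof -
    have "2 * (half * card M) = card M * (order R - 1)" unfolding two_half[symmetric] by simp
    also have "\<dots> = 2 * K.half" unfolding K.two_half ordK M_def by (rule card_monic_length_le)
    finally show ?thesis by simp
  qed
  ultimately have "?y [^]\<^bsub>?K\<^esub> K.half = \<one>\<^bsub>?K\<^esub>" using h.S.nat_pow_pow[OF y] by simp
  then obtain z where z: "z \<in> carrier ?K" "?y = z \<otimes>\<^bsub>?K\<^esub> z" using K.square_if_pow_half[OF y] by blast
  obtain C where C: "C \<in> carrier P" "z = \<phi> C" using z(1) img by blast
  have "\<phi> (C \<otimes>\<^bsub>P\<^esub> C \<oplus>\<^bsub>P\<^esub> X) = ?y \<oplus>\<^bsub>?K\<^esub> \<phi> X" unfolding z(2) C(2) using C(1) by simp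
  also have "\<dots> = \<zero>\<^bsub>?K\<^esub>" by (simp add: h.S.l_neg)
  finally have z0: "\<phi> (C \<otimes>\<^bsub>P\<^esub> C \<oplus>\<^bsub>P\<^esub> X) = \<zero>\<^bsub>?K\<^esub>" .
  have "C \<otimes>\<^bsub>P\<^esub> C \<oplus>\<^bsub>P\<^esub> X \<in> carrier P" using C(1) by simp
  from iffD1[OF phi_zero[OF this] z0] show ?thesis using C(1) by blast
qed

text \<open>A square root of \<open>-T\<close> modulo \<open>p\<close> refutes inertness with
  \<open>B = 1\<close>, and the dichotomy then represents \<open>p\<close>. So splitting of
  \<open>p\<close> depends on \<open>p(0)\<close> alone, which makes the character computable on all
  monic polynomials.\<close>

lemma qform_mprime_iff:
  assumes p: "mprime p" "const_term p \<noteq> \<zero>"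
  shows "UP.qform X p \<longleftrightarrow> qchar (const_term p) = 1"
proof
  assume "UP.qform X p" then show "qchar (const_term p) = 1" using const_term_sum_squares p(2) by blast
next
  assume q: "qchar (const_term p) = 1"
  obtain C where C: "C \<in> carrier P" "p divides\<^bsub>P\<^esub> (C \<otimes>\<^bsub>P\<^esub> C \<oplus>\<^bsub>P\<^esub> X)" using minus_X_square[OF p(1) q] by blast
  have "\<not> p divides\<^bsub>P\<^esub> \<one>\<^bsub>P\<^esub>"
    using pdivides_imp_degree_le[OF carrier_is_subring mprime_carrier[OF p(1)] UP.one_closed] mprime_degree[OF p(1)]
    unfolding pdivides_def by (auto simp: univ_poly_one)
  moreover have "C \<otimes>\<^bsub>P\<^esub> C \<oplus>\<^bsub>P\<^esub> X \<otimes>\<^bsub>P\<^esub> (\<one>\<^bsub>P\<^esub> \<otimes>\<^bsub>P\<^esub> \<one>\<^bsub>P\<^esub>) = C \<otimes>\<^bsub>P\<^esub> C \<oplus>\<^bsub>P\<^esub> X" by simp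
  ultimately have "\<not> UP.inert X p" unfolding UP.inert_def using C by (metis UP.one_closed)
  then show "UP.qform X p" using qform_or_inert[OF p(1)] by blast
qed

end

section \<open>Euler products\<close>

context odd_finite_field
begin

section \<open>Splitting off the power of one prime\<close>

lemma mprime_not_dvd_one: "mprime p \<Longrightarrow> \<not> p divides\<^bsub>P\<^esub> \<one>\<^bsub>P\<^esub>"
  using pdivides_imp_degree_le[OF carrier_is_subring mprime_carrier UP.one_closed, of p] mprime_degree[of p]
  unfolding pdivides_def by (auto simp: univ_poly_one)

lemma mprime_dvd_pow:
  assumes "mprime r" "mprime p" "r divides\<^bsub>P\<^esub> (p [^]\<^bsub>P\<^esub> (k::nat))" shows "r = p"
  using assms(3)
proof (induction k)
  case 0 then show ?case using mprime_not_dvd_one[OF assms(1)] by simp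
next
  case (Suc k)
  have pc: "p \<in> carrier P" using mprime_carrier[OF assms(2)] .
  then have "p [^]\<^bsub>P\<^esub> k \<in> carrier P" by simp
  then have "r divides\<^bsub>P\<^esub> (p [^]\<^bsub>P\<^esub> k) \<or> r divides\<^bsub>P\<^esub> p"
    using mprimeD[OF assms(1) _ pc] Suc.prems by simp
  then show ?case using Suc.IH mprime_dvd_mprime[OF assms(1,2)] by blast
qed

lemma prime_power_decomp:
  assumes p: "mprime p" and "monic f"
  shows "\<exists>k g. monic g \<and> f = p [^]\<^bsub>P\<^esub> (k::nat) \<otimes>\<^bsub>P\<^esub> g \<and> \<not> p divides\<^bsub>P\<^esub> g"
  using assms(2)
proof (induction "degree f" arbitrary: f rule: less_induct)
  case less
  have pc: "p \<in> carrier P" "monic p" using p mprime_carrier by (auto simp: mprime_def)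
  show ?case
  proof (cases "p divides\<^bsub>P\<^esub> f")
    case False
    then show ?thesis using less.prems by (intro exI[of _ 0] exI[of _ f]) (auto simp: monic_def)
  next
    case True
    then obtain g where g: "g \<in> carrier P" "f = p \<otimes>\<^bsub>P\<^esub> g" by (auto elim: dividesE)
    then have gm: "monic g" using monic_cancel[OF pc(2)] less.prems by blast
    then have "degree g < degree f" using degree_mult[OF pc(2) gm] mprime_degree[OF p] g(2) by simp
    then obtain k h where h: "monic h" "g = p [^]\<^bsub>P\<^esub> (k::nat) \<otimes>\<^bsub>P\<^esub> h" "\<not> p divides\<^bsub>P\<^esub> h"
      using less.hyps[OF _ gm] by blast
    then have "h \<in> carrier P" by (simp add: monic_def)
    then have "f = p [^]\<^bsub>P\<^esub> Suc k \<otimes>\<^bsub>P\<^esub> h"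
      unfolding g(2) h(2) using pc(1) by (simp add: UP.m_ac)
    then show ?thesis using h by blast
  qed
qed

lemma prime_power_decomp_unique:
  assumes p: "mprime p" and gh: "g \<in> carrier P" "h \<in> carrier P" "\<not> p divides\<^bsub>P\<^esub> g" "\<not> p divides\<^bsub>P\<^esub> h"
    and e: "p [^]\<^bsub>P\<^esub> (k::nat) \<otimes>\<^bsub>P\<^esub> g = p [^]\<^bsub>P\<^esub> (l::nat) \<otimes>\<^bsub>P\<^esub> h"
  shows "k = l \<and> g = h"
proof -
  have pc: "p \<in> carrier P" using p mprime_carrier by blast
  have p0: "p [^]\<^bsub>P\<^esub> i \<noteq> \<zero>\<^bsub>P\<^esub>" for i :: nat
    using monic_pow[of p i] p unfolding mprime_def monic_def univ_poly_zero by blast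
  have *: "k = l \<and> g = h"
    if gh: "g \<in> carrier P" "h \<in> carrier P" "\<not> p divides\<^bsub>P\<^esub> g" and le: "k \<le> l"
      and e: "p [^]\<^bsub>P\<^esub> k \<otimes>\<^bsub>P\<^esub> g = p [^]\<^bsub>P\<^esub> l \<otimes>\<^bsub>P\<^esub> h" for g h and k l :: nat
  proof -
    obtain j where j: "l = k + j" using le by (auto simp: le_iff_add)
    have "p [^]\<^bsub>P\<^esub> k \<otimes>\<^bsub>P\<^esub> g = p [^]\<^bsub>P\<^esub> k \<otimes>\<^bsub>P\<^esub> (p [^]\<^bsub>P\<^esub> j \<otimes>\<^bsub>P\<^esub> h)"
      unfolding e j using pc gh by (simp add: UP.nat_pow_mult[symmetric] UP.m_assoc)
    then have g: "g = p [^]\<^bsub>P\<^esub> j \<otimes>\<^bsub>P\<^esub> h"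
      using UP.m_lcancel[OF p0[of k], of g "p [^]\<^bsub>P\<^esub> j \<otimes>\<^bsub>P\<^esub> h"] pc gh by simp
    have "j = 0"
    proof (rule ccontr)
      assume "j \<noteq> 0"
      then obtain i where "j = Suc i" by (cases j) auto
      then have "g = p \<otimes>\<^bsub>P\<^esub> (p [^]\<^bsub>P\<^esub> i \<otimes>\<^bsub>P\<^esub> h)" unfolding g using pc gh by (simp add: UP.m_ac)
      then have "p divides\<^bsub>P\<^esub> g" using dividesI[of "p [^]\<^bsub>P\<^esub> i \<otimes>\<^bsub>P\<^esub> h" P g p] pc gh(2) by simp
      then show False using gh(3) by blast
    qed
    then show ?thesis using g j gh by simp
  qed
  show ?thesis
  proof (cases "k \<le> l")
    case True then show ?thesis using *[OF gh(1,2,3) True e] by blast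
  next
    case False then show ?thesis using *[OF gh(2,1,4) _ e[symmetric]] by auto
  qed
qed

text \<open>The index set of a partial Euler product in degree \<open>n\<close>: adjoining a prime
  to \<open>S\<close> multiplies in one more factor.\<close>

definition smooth :: "'a list set \<Rightarrow> nat \<Rightarrow> 'a list set" where
  "smooth S n = {f \<in> monic_polys R n. \<forall>p. mprime p \<and> p divides\<^bsub>P\<^esub> f \<longrightarrow> p \<in> S}"

lemma finite_smooth [simp]: "finite (smooth S n)"
  unfolding smooth_def using finite_monic_polys by simp

lemma smooth_empty: "smooth {} n = (if n = 0 then {\<one>\<^bsub>P\<^esub>} else {})"
proof (cases "n = 0")
  case True
  then show ?thesis
    unfolding smooth_def monic_polys_eq using monic_degree_0 monic_one mprime_not_dvd_one
    by (auto simp: univ_poly_one)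
next
  case False
  then show ?thesis
    unfolding smooth_def monic_polys_eq using exists_mprime_divisor by fastforce
qed

text \<open>The \<open>p\<close>-part of \<open>f\<close> is indexed by its degree \<open>i\<close>
  and not by its exponent, so that a sum over the pairs is literally a coefficient of a Cauchy
  product.\<close>

lemma smooth_insert:
  assumes p: "mprime p" and pS: "p \<notin> S"
  shows "bij_betw (\<lambda>(i, g). p [^]\<^bsub>P\<^esub> (i div degree p) \<otimes>\<^bsub>P\<^esub> g)
    (SIGMA i:{i \<in> {0..n}. degree p dvd i}. smooth S (n - i)) (smooth (insert p S) n)"
proof -
  let ?d = "degree p"
  let ?F = "\<lambda>(i, g). p [^]\<^bsub>P\<^esub> (i div ?d) \<otimes>\<^bsub>P\<^esub> g"
  let ?A = "SIGMA i:{i \<in> {0..n}. ?d dvd i}. smooth S (n - i)"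
  have pm: "monic p" "p \<in> carrier P" using p mprime_carrier by (auto simp: mprime_def)
  have d: "?d \<ge> 1" using mprime_degree[OF p] .
  have sm: "monic g" "degree g = m" "\<not> p divides\<^bsub>P\<^esub> g" "g \<in> carrier P" if "g \<in> smooth S m" for g m
    using that p pS unfolding smooth_def monic_polys_eq by (auto simp: monic_def)
  have "inj_on ?F ?A"
  proof (rule inj_onI, clarify)
    fix i g j h
    assume a: "i \<in> {0..n}" "?d dvd i" "g \<in> smooth S (n - i)" "j \<in> {0..n}" "?d dvd j" "h \<in> smooth S (n - j)"
      "p [^]\<^bsub>P\<^esub> (i div ?d) \<otimes>\<^bsub>P\<^esub> g = p [^]\<^bsub>P\<^esub> (j div ?d) \<otimes>\<^bsub>P\<^esub> h"
    have "i div ?d = j div ?d \<and> g = h"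
      using prime_power_decomp_unique[OF p _ _ _ _ a(7)] sm[OF a(3)] sm[OF a(6)] by blast
    then show "i = j \<and> g = h" using a(2,5) by (metis dvd_div_mult_self)
  qed
  moreover have "?F ` ?A = smooth (insert p S) n"
  proof (intro equalityI subsetI)
    fix f assume "f \<in> ?F ` ?A"
    then obtain i g where ig: "i \<le> n" "?d dvd i" "g \<in> smooth S (n - i)" "f = p [^]\<^bsub>P\<^esub> (i div ?d) \<otimes>\<^bsub>P\<^esub> g" by auto
    have f: "monic f" "degree f = n"
      unfolding ig(4) using monic_mult[OF monic_pow[OF pm(1)] sm(1)[OF ig(3)]]
        degree_mult[OF monic_pow[OF pm(1)] sm(1)[OF ig(3)], of "i div ?d"] degree_pow[OF pm(1), of "i div ?d"]
        sm(2)[OF ig(3)] ig(1,2) by auto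
    have "r \<in> insert p S" if r: "mprime r" "r divides\<^bsub>P\<^esub> f" for r
    proof -
      have "r divides\<^bsub>P\<^esub> (p [^]\<^bsub>P\<^esub> (i div ?d)) \<or> r divides\<^bsub>P\<^esub> g"
        using mprimeD[OF r(1), of "p [^]\<^bsub>P\<^esub> (i div ?d)" g] r(2) pm(2) sm(4)[OF ig(3)] unfolding ig(4) by simp
      then show ?thesis
        using mprime_dvd_pow[OF r(1) p] r(1) ig(3) unfolding smooth_def by blast
    qed
    then show "f \<in> smooth (insert p S) n" unfolding smooth_def monic_polys_eq using f by blast
  next
    fix f assume f: "f \<in> smooth (insert p S) n"
    then have fm: "monic f" "degree f = n" unfolding smooth_def monic_polys_eq by auto
    obtain k g where kg: "monic g" "f = p [^]\<^bsub>P\<^esub> (k::nat) \<otimes>\<^bsub>P\<^esub> g" "\<not> p divides\<^bsub>P\<^esub> g"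
      using prime_power_decomp[OF p fm(1)] by blast
    have gc: "g \<in> carrier P" using kg(1) by (simp add: monic_def)
    have deg: "n = k * ?d + degree g"
      using degree_mult[OF monic_pow[OF pm(1), of k] kg(1)] degree_pow[OF pm(1), of k] fm(2) kg(2) by simp
    have "r \<in> S" if r: "mprime r" "r divides\<^bsub>P\<^esub> g" for r
    proof -
      have "r divides\<^bsub>P\<^esub> f"
        unfolding kg(2) by (rule UP.divides_prod_l) (use mprime_carrier[OF r(1)] gc pm(2) r(2) in auto)
      then have "r \<in> insert p S" using f r(1) unfolding smooth_def by blast
      then show ?thesis using kg(3) r(2) by blast
    qed
    then have "g \<in> smooth S (n - k * ?d)" unfolding smooth_def monic_polys_eq using kg(1) deg by auto
    moreover have "f = ?F (k * ?d, g)" using kg(2) d by simp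
    moreover have "k * ?d \<in> {i \<in> {0..n}. ?d dvd i}" using deg by simp
    ultimately show "f \<in> ?F ` ?A" by blast
  qed
  ultimately show ?thesis unfolding bij_betw_def by blast
qed

end

section \<open>Formal Euler factors and finite Euler products\<close>

definition euler_factor :: "nat \<Rightarrow> (nat \<Rightarrow> real) \<Rightarrow> real fps" where
  "euler_factor d h = Abs_fps (\<lambda>m. if d dvd m then h (m div d) else 0)"

lemma euler_factor_nth: "euler_factor d h $ m = (if d dvd m then h (m div d) else 0)"
  by (simp add: euler_factor_def)

text \<open>Only finite sets of primes occur, so there is no question of convergence. The weight has
  to be multiplicative only between a prime power and a cofactor prime to it, which is what the
  criteria for \<open>qform\<close> provide.\<close>

lemma (in odd_finite_field) euler_product:
  fixes w :: "'a list \<Rightarrow> real"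
  assumes "finite S" "\<And>p. p \<in> S \<Longrightarrow> mprime p" and w1: "w \<one>\<^bsub>P\<^esub> = 1"
    and w: "\<And>p g k. p \<in> S \<Longrightarrow> monic g \<Longrightarrow> \<not> p divides\<^bsub>P\<^esub> g \<Longrightarrow> w (p [^]\<^bsub>P\<^esub> (k::nat) \<otimes>\<^bsub>P\<^esub> g) = h p k * w g"
  shows "(\<Sum>f\<in>smooth S n. w f) = (\<Prod>p\<in>S. euler_factor (degree p) (h p)) $ n"
  using assms(1,2) w
proof (induction S arbitrary: n rule: finite_induct)
  case empty
  then show ?case using w1 by (simp add: smooth_empty)
next
  case (insert p S)
  let ?d = "degree p"
  have p: "mprime p" using insert by blast
  have IH: "(\<Sum>f\<in>smooth S n. w f) = (\<Prod>p\<in>S. euler_factor (degree p) (h p)) $ n" for n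
    using insert by blast
  have "(\<Prod>p\<in>insert p S. euler_factor (degree p) (h p)) $ n =
      (\<Sum>i=0..n. euler_factor ?d (h p) $ i * (\<Prod>p\<in>S. euler_factor (degree p) (h p)) $ (n - i))"
    using insert(1,2) by (simp add: fps_mult_nth)
  also have "\<dots> = (\<Sum>i=0..n. if ?d dvd i then (\<Sum>g\<in>smooth S (n - i). h p (i div ?d) * w g) else 0)"
    by (intro sum.cong refl) (simp add: IH euler_factor_nth sum_distrib_left[symmetric] del: One_nat_def)
  also have "\<dots> = (\<Sum>i\<in>{i \<in> {0..n}. ?d dvd i}. \<Sum>g\<in>smooth S (n - i). h p (i div ?d) * w g)"
    by (rule sum.inter_filter[symmetric]) simp
  also have "\<dots> = (\<Sum>(i, g)\<in>(SIGMA i:{i \<in> {0..n}. ?d dvd i}. smooth S (n - i)). h p (i div ?d) * w g)"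
    by (rule sum.Sigma) auto
  also have "\<dots> = (\<Sum>x\<in>(SIGMA i:{i \<in> {0..n}. ?d dvd i}. smooth S (n - i)). w ((\<lambda>(i, g). p [^]\<^bsub>P\<^esub> (i div ?d) \<otimes>\<^bsub>P\<^esub> g) x))"
  proof (intro sum.cong refl, clarify)
    fix i g assume "g \<in> smooth S (n - i)"
    then have "monic g" "\<not> p divides\<^bsub>P\<^esub> g" using p insert(2) unfolding smooth_def monic_polys_eq by auto
    then show "h p (i div ?d) * w g = w (p [^]\<^bsub>P\<^esub> (i div ?d) \<otimes>\<^bsub>P\<^esub> g)" using insert.prems(2)[of p g] by simp
  qed
  also have "\<dots> = (\<Sum>f\<in>smooth (insert p S) n. w f)"
    by (rule sum.reindex_bij_betw[OF smooth_insert[OF p insert(2)]])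
  finally show ?case by simp
qed

lemma euler_factor_compose: "euler_factor d h oo fps_X ^ 2 = euler_factor (2 * d) h"
proof (rule fps_ext)
  fix n
  show "(euler_factor d h oo fps_X ^ 2) $ n = euler_factor (2 * d) h $ n"
  proof (cases "even n")
    case True
    then obtain m where "n = 2 * m" by (elim evenE)
    then show ?thesis by (simp add: fps_nth_compose_X_power euler_factor_nth)
  next
    case False
    then have "\<not> 2 * d dvd n" by (meson dvd_mult_left)
    then show ?thesis using False by (simp add: fps_nth_compose_X_power euler_factor_nth)
  qed
qed

lemma euler_factor_even: "d \<ge> 1 \<Longrightarrow> euler_factor d (\<lambda>k. of_bool (even k)) = euler_factor (2 * d) (\<lambda>k. 1)"
proof (rule fps_ext)
  fix n assume d: "d \<ge> 1"
  show "euler_factor d (\<lambda>k. of_bool (even k)) $ n = euler_factor (2 * d) (\<lambda>k. 1) $ n"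
  proof (cases "d dvd n")
    case True
    then obtain m where "n = d * m" by (elim dvdE)
    then show ?thesis using d by (simp add: euler_factor_nth mult.commute[of 2 d])
  next
    case False
    then have "\<not> 2 * d dvd n" by (meson dvd_mult_right)
    then show ?thesis using False by (simp add: euler_factor_nth)
  qed
qed

lemma euler_factor_geometric:
  assumes "d \<ge> 1" shows "euler_factor d (\<lambda>k. c ^ k) * (1 - fps_const c * fps_X ^ d) = 1"
proof (rule fps_ext)
  fix n
  have "(euler_factor d (\<lambda>k. c ^ k) * (1 - fps_const c * fps_X ^ d)) $ n
    = euler_factor d (\<lambda>k. c ^ k) $ n - c * (if n < d then 0 else euler_factor d (\<lambda>k. c ^ k) $ (n - d))"
    by (simp add: right_diff_distrib mult.left_commute[of _ "fps_const c"] fps_X_power_mult_right_nth)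
  also have "\<dots> = 1 $ n"
  proof (cases "d dvd n")
    case True
    then obtain m where "n = d * m" by (elim dvdE)
    then show ?thesis using assms by (cases m) (auto simp: euler_factor_nth)
  next
    case False
    then have "n \<noteq> 0" "n \<ge> d \<Longrightarrow> \<not> d dvd (n - d)" by (auto intro: dvd_diffD1 simp: dvd_minus_self)
    then show ?thesis using False by (auto simp: euler_factor_nth)
  qed
  finally show "(euler_factor d (\<lambda>k. c ^ k) * (1 - fps_const c * fps_X ^ d)) $ n = 1 $ n" .
qed

lemma euler_factor_one: "d \<ge> 1 \<Longrightarrow> euler_factor d (\<lambda>k. 1) * (1 - fps_X ^ d) = 1"
  using euler_factor_geometric[of d 1] by simp

lemma euler_factor_minus_one: "d \<ge> 1 \<Longrightarrow> euler_factor d (\<lambda>k. (-1) ^ k) * (1 + fps_X ^ d) = 1"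
  using euler_factor_geometric[of d "-1"] by (simp flip: fps_const_neg)

text \<open>With \<open>v = X^d\<close> this is the inverse of
  \<open>(1 - v)(1 + v) = 1 - v^2\<close>: at an inert prime the zeta factor times the L-factor is
  the factor of the even powers.\<close>

lemma euler_factor_conj:
  assumes "d \<ge> 1"
  shows "euler_factor d (\<lambda>k. 1) * euler_factor d (\<lambda>k. (-1) ^ k) = euler_factor (2 * d) (\<lambda>k. 1)"
proof -
  let ?a = "euler_factor d (\<lambda>k. 1)" and ?b = "euler_factor d (\<lambda>k. (-1) ^ k)" and ?c = "euler_factor (2 * d) (\<lambda>k. 1)"
  let ?v = "fps_X ^ d :: real fps"
  have c: "?c * (1 - ?v * ?v) = 1"
    using euler_factor_one[of "2 * d"] assms by (simp add: mult_2 power_add)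
  have "?a * ?b = (?a * (1 - ?v)) * (?b * (1 + ?v)) * ?c"
  proof -
    have "?a * ?b = ?a * ?b * (?c * (1 - ?v * ?v))" unfolding c by simp
    then show ?thesis by (simp add: algebra_simps)
  qed
  then show ?thesis unfolding euler_factor_one[OF assms] euler_factor_minus_one[OF assms] by simp
qed

text \<open>Replaces equality with an infinite Euler product: primes of degree above
  \<open>N\<close> cannot influence coefficients up to \<open>N\<close>.\<close>

definition fps_agree :: "nat \<Rightarrow> real fps \<Rightarrow> real fps \<Rightarrow> bool" where
  "fps_agree N a b \<longleftrightarrow> (\<forall>n\<le>N. a $ n = b $ n)"

lemma fps_agree_mult: "fps_agree N a b \<Longrightarrow> fps_agree N c d \<Longrightarrow> fps_agree N (a * c) (b * d)"
  unfolding fps_agree_def fps_mult_nth by (auto intro!: sum.cong)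

lemma fps_agree_compose: "fps_agree N a b \<Longrightarrow> fps_agree N (a oo fps_X ^ 2) (b oo fps_X ^ 2)"
  unfolding fps_agree_def by (auto simp: fps_nth_compose_X_power)

lemma fps_agree_refl: "fps_agree N a a"
  by (simp add: fps_agree_def)

context odd_finite_field
begin

section \<open>The functional equation of the generating function\<close>

lemma b_ind_eq: "b_ind R f = of_bool (UP.qform X f)"
  unfolding b_ind_def UP.qform_def numeral_2_eq_2
  by (auto simp: UP.nat_pow_Suc)

lemma mprime_X: "mprime X"
proof -
  have "pirreducible (carrier R) X"
    by (rule degree_one_imp_pirreducible[OF carrier_is_subfield X_carrier]) (simp add: var_def)
  then show ?thesis
    using pprime_iff_pirreducible[OF carrier_is_subfield X_carrier] X_carrier unfolding mprime_def monic_def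
    by (simp add: var_def)
qed

lemma qform_X: "UP.qform X X"
proof -
  have "X = \<zero>\<^bsub>P\<^esub> \<otimes>\<^bsub>P\<^esub> \<zero>\<^bsub>P\<^esub> \<oplus>\<^bsub>P\<^esub> X \<otimes>\<^bsub>P\<^esub> (\<one>\<^bsub>P\<^esub> \<otimes>\<^bsub>P\<^esub> \<one>\<^bsub>P\<^esub>)" by simp
  then show ?thesis unfolding UP.qform_def by blast
qed

lemma const_term_X: "const_term X = \<zero>"
  using eval_var[OF zero_closed] by (simp add: const_term_def)

lemma const_term_mprime: "mprime p \<Longrightarrow> const_term p = \<zero> \<Longrightarrow> p = X"
proof -
  assume p: "mprime p" "const_term p = \<zero>"
  then have pp: "polynomial (carrier R) p" "p \<noteq> []" by (auto simp: mprime_def monic_def univ_poly_carrier)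
  obtain m where m: "polynomial (carrier R) m" "m \<noteq> []" "p = m @ [\<zero>]"
    using const_term_zero[OF carrier_is_subring pp p(2)] by blast
  then have mc: "m \<in> carrier P" by (simp add: univ_poly_carrier)
  then have "p = X \<otimes>\<^bsub>P\<^esub> m" using X_mult_Cons m by simp
  then have "X divides\<^bsub>P\<^esub> p" using mc by (metis dividesI)
  then show "p = X" using mprime_dvd_mprime[OF mprime_X p(1)] by simp
qed

definition mprimes_upto :: "nat \<Rightarrow> 'a list set" where
  "mprimes_upto N = {p. mprime p \<and> degree p \<le> N}"

lemma finite_mprimes_upto: "finite (mprimes_upto N)"
proof (rule finite_subset)
  show "mprimes_upto N \<subseteq> (\<Union>n\<le>N. monic_polys R n)"
    unfolding mprimes_upto_def monic_polys_eq mprime_def by auto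
qed (use finite_monic_polys in auto)

lemma smooth_upto:
  assumes "n \<le> N" shows "smooth (mprimes_upto N) n = monic_polys R n"
proof -
  have "degree p \<le> N" if "mprime p" "p divides\<^bsub>P\<^esub> f" "f \<in> monic_polys R n" for p f
    using pdivides_imp_degree_le[OF carrier_is_subring mprime_carrier[OF that(1)], of f] that assms
    unfolding pdivides_def monic_polys_eq monic_def by auto
  then show ?thesis unfolding smooth_def mprimes_upto_def by auto
qed

lemma euler_product_upto:
  assumes "n \<le> N" and w1: "w \<one>\<^bsub>P\<^esub> = 1"
    and w: "\<And>p g k. mprime p \<Longrightarrow> monic g \<Longrightarrow> \<not> p divides\<^bsub>P\<^esub> g \<Longrightarrow> w (p [^]\<^bsub>P\<^esub> (k::nat) \<otimes>\<^bsub>P\<^esub> g) = h p k * w g"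
  shows "(\<Prod>p\<in>mprimes_upto N. euler_factor (degree p) (h p)) $ n = (\<Sum>f\<in>monic_polys R n. w f)"
  using euler_product[OF finite_mprimes_upto, of N w h n, OF _ w1] w smooth_upto[OF assms(1)]
  unfolding mprimes_upto_def by auto

text \<open>In positive degree the last coefficient runs freely over the field, so the sum is a
  multiple of the vanishing character sum. This is the statement that the L-function equals
  1.\<close>

lemma sum_qchar_const_term: "(\<Sum>f\<in>monic_polys R n. qchar (const_term f)) = of_bool (n = 0)"
proof (cases n)
  case 0
  have "monic_polys R 0 = {\<one>\<^bsub>P\<^esub>}" unfolding monic_polys_eq using monic_degree_0 monic_one by (auto simp: univ_poly_one)
  then show ?thesis using 0 by (simp add: univ_poly_one const_term_def)
next
  case (Suc m)
  have "monic_polys R n = (\<lambda>(f, a). f @ [a]) ` (monic_polys R m \<times> carrier R)"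
  proof (intro equalityI subsetI)
    fix f assume "f \<in> monic_polys R n"
    then obtain xs where xs: "f = \<one> # xs" "set xs \<subseteq> carrier R" "length xs = Suc m"
      unfolding monic_polys_Cons Suc by auto
    then obtain ys a where ya: "xs = ys @ [a]" by (cases xs rule: rev_cases) auto
    then have "\<one> # ys \<in> monic_polys R m" "a \<in> carrier R" using xs unfolding monic_polys_Cons by auto
    then show "f \<in> (\<lambda>(f, a). f @ [a]) ` (monic_polys R m \<times> carrier R)" using xs ya by (auto intro!: image_eqI[of _ _ "(\<one> # ys, a)"])
  next
    fix f assume "f \<in> (\<lambda>(f, a). f @ [a]) ` (monic_polys R m \<times> carrier R)"
    then show "f \<in> monic_polys R n" unfolding monic_polys_Cons Suc by auto
  qed
  note snoc = this
  have inj: "inj_on (\<lambda>(f, a). f @ [a]) (monic_polys R m \<times> carrier R)" by (auto simp: inj_on_def)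
  have "(\<Sum>f\<in>monic_polys R n. qchar (const_term f))
      = (\<Sum>(f, a)\<in>monic_polys R m \<times> carrier R. qchar (const_term (f @ [a])))"
    unfolding snoc sum.reindex[OF inj] by (simp add: case_prod_beta)
  also have "\<dots> = (\<Sum>(f, a)\<in>monic_polys R m \<times> carrier R. qchar a)"
    by (intro sum.cong refl) (auto simp: monic_polys_eq monic_def poly_carrier_iff const_term_eq_last)
  also have "\<dots> = 0" by (simp add: sum.cartesian_product[symmetric] sum_qchar)
  finally show ?thesis using Suc by simp
qed

definition B_series :: "real fps" where
  "B_series = Abs_fps (\<lambda>n. real (B_count R n))"

lemma B_series_functional_equation:
  "B_series ^ 2 * (1 - fps_const (real (order R)) * fps_X) = (1 + fps_X) * (B_series oo fps_X ^ 2)"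
proof -
  define Z where "Z = Abs_fps (\<lambda>n. real (order R) ^ n)"
  define z :: "'a list \<Rightarrow> real fps" where "z p = euler_factor (degree p) (\<lambda>k. 1)" for p
  define l where "l p = euler_factor (degree p) (\<lambda>k. qchar (const_term p) ^ k)" for p
  define b where "b p = euler_factor (degree p) (\<lambda>k. of_bool (UP.qform X p \<or> even k))" for p
  note ct = const_term_simprules_shell[OF carrier_is_subring]
  have Z: "fps_agree N (\<Prod>p\<in>mprimes_upto N. z p) Z" for N
    unfolding fps_agree_def z_def Z_def
    using euler_product_upto[of _ N "\<lambda>_. 1" "\<lambda>_ _. 1"] by (simp add: card_monic_polys)
  have L: "fps_agree N (\<Prod>p\<in>mprimes_upto N. l p) 1" for N
  proof -
    have "qchar (const_term (p [^]\<^bsub>P\<^esub> (k::nat) \<otimes>\<^bsub>P\<^esub> g)) = qchar (const_term p) ^ k * qchar (const_term g)"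
      if "mprime p" "monic g" for p g k
    proof -
      have c: "p \<in> carrier P" "g \<in> carrier P" using that mprime_carrier by (auto simp: monic_def)
      have "qchar (const_term (p [^]\<^bsub>P\<^esub> k)) = qchar (const_term p) ^ k"
      proof (induction k)
        case 0 then show ?case by (simp add: univ_poly_one const_term_def)
      next
        case (Suc k)
        then show ?case using c(1) by (simp add: ct qchar_mult)
      qed
      then show ?thesis using c by (simp add: ct qchar_mult)
    qed
    then have "(\<Prod>p\<in>mprimes_upto N. l p) $ n = (\<Sum>f\<in>monic_polys R n. qchar (const_term f))" if "n \<le> N" for n
      unfolding l_def using that by (intro euler_product_upto) (auto simp: univ_poly_one const_term_def)
    then show ?thesis unfolding fps_agree_def sum_qchar_const_term by simp
  qed
  have B: "fps_agree N (\<Prod>p\<in>mprimes_upto N. b p) B_series" for N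
  proof -
    have w: "real (b_ind R (p [^]\<^bsub>P\<^esub> (k::nat) \<otimes>\<^bsub>P\<^esub> g)) = of_bool (UP.qform X p \<or> even k) * real (b_ind R g)"
      if p: "mprime p" and g: "monic g" and nd: "\<not> p divides\<^bsub>P\<^esub> g" for p g k
    proof -
      have c: "p \<in> carrier P" "g \<in> carrier P" "ring_prime\<^bsub>P\<^esub> p" using p g mprime_carrier by (auto simp: monic_def mprime_def)
      show ?thesis
      proof (cases "UP.qform X p")
        case True
        then show ?thesis
          unfolding b_ind_eq using UP.qform_prime_power[OF X_carrier c(3,1,2) True, of k] by simp
      next
        case False
        then have "UP.inert X p" using qform_or_inert[OF p] by blast
        then show ?thesis
          unfolding b_ind_eq using UP.qform_prime_power_inert[OF X_carrier c(3,1,2) _ nd, of k] False by simp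
      qed
    qed
    have w1: "real (b_ind R \<one>\<^bsub>P\<^esub>) = 1"
      unfolding b_ind_eq using UP.qform_square[OF X_carrier UP.one_closed] by simp
    have "(\<Prod>p\<in>mprimes_upto N. b p) $ n = (\<Sum>f\<in>monic_polys R n. real (b_ind R f))" if "n \<le> N" for n
      unfolding b_def using that w w1 by (intro euler_product_upto) auto
    then show ?thesis unfolding fps_agree_def B_series_def B_count_def by simp
  qed
  \<comment> \<open>Let \<open>v = u^d\<close>. At a represented prime other than \<open>T\<close>,
    all three factors are \<open>1/(1 - v)\<close>. At an inert one \<open>z = 1/(1 - v)\<close>,
    \<open>l = 1/(1 + v)\<close>, \<open>b = 1/(1 - v^2)\<close>, and both sides are
    \<open>b / (1 - v^4)\<close>. Only \<open>T\<close>, where the character vanishes, leaves an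
    extra factor \<open>1 + u\<close>. The factor \<open>l\<close> at \<open>u^2\<close> on the left
    is what makes one identity fit both other cases.\<close>
  have factor_eq: "b p * b p * (l p oo fps_X ^ 2) = z p * (b p oo fps_X ^ 2) * l p * (if p = X then 1 + fps_X else 1)"
    if p: "mprime p" for p
  proof -
    define d where "d = degree p"
    have d: "d \<ge> 1" unfolding d_def using mprime_degree[OF p] .
    consider "p = X" | "p \<noteq> X" "UP.qform X p" | "p \<noteq> X" "\<not> UP.qform X p" by blast
    then show ?thesis
    proof cases
      case 1
      then have d1: "d = 1" by (simp add: d_def var_def)
      let ?a = "euler_factor 1 (\<lambda>k. 1)" and ?c = "euler_factor 2 (\<lambda>k. 1)"
      \<comment> \<open>The character of the constant term 0 is 0, and \<open>0 ^ 0 = 1\<close>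
        keeps just the constant coefficient.\<close>
      have l: "l p = 1" unfolding l_def 1 const_term_X
        by (rule fps_ext) (auto simp: euler_factor_nth var_def power_0_left)
      have b: "b p = ?a" "z p = ?a"
        unfolding b_def z_def d_def[symmetric] d1 using qform_X 1 by simp_all
      have a: "?a * (1 - fps_X) = 1" using euler_factor_one[of 1] by simp
      have c: "?c * (1 - fps_X ^ 2) = 1" using euler_factor_one[of 2] by simp
      have "?a = ?a * (?c * (1 - fps_X ^ 2))" unfolding c by simp
      also have "\<dots> = (?a * (1 - fps_X)) * ?c * (1 + fps_X)" by (simp add: power2_eq_square algebra_simps)
      finally have "?a = ?c * (1 + fps_X)" unfolding a by simp
      then have "?a * ?a = ?a * (?c * (1 + fps_X))" by simp
      then show ?thesis unfolding b l using 1 by (simp add: euler_factor_compose mult_ac)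
    next
      case 2
      then have "qchar (const_term p) = 1" using const_term_mprime[OF p] qform_mprime_iff[OF p] by blast
      then have "l p = euler_factor (degree p) (\<lambda>k. 1 ^ k)" by (simp only: l_def)
      also have "\<dots> = z p" unfolding z_def by (rule arg_cong[of _ _ "euler_factor (degree p)"]) (rule ext, simp)
      finally have "l p = z p" .
      moreover have "b p = z p" unfolding z_def b_def using 2 by simp
      ultimately have "l p = z p" "b p = z p" by simp_all
      then show ?thesis using 2 by (simp add: mult_ac)
    next
      case 3
      then have n0: "const_term p \<noteq> \<zero>" using const_term_mprime[OF p] by blast
      then have "qchar (const_term p) = -1" using qform_mprime_iff[OF p n0] 3 qchar_cases by blast
      then have l: "l p = euler_factor d (\<lambda>k. (-1) ^ k)" unfolding l_def d_def by simp
      have b: "b p = euler_factor (2 * d) (\<lambda>k. 1)"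
        unfolding b_def d_def[symmetric] using 3 euler_factor_even[OF d] by simp
      have z: "z p = euler_factor d (\<lambda>k. 1)" unfolding z_def d_def ..
      have c: "euler_factor (2 * d) (\<lambda>k. 1) * euler_factor (2 * d) (\<lambda>k. (-1) ^ k) = euler_factor (2 * (2 * d)) (\<lambda>k. 1)"
        using euler_factor_conj[of "2 * d"] d by simp
      have "b p * b p * (l p oo fps_X ^ 2) = b p * euler_factor (2 * (2 * d)) (\<lambda>k. 1)"
        unfolding b l euler_factor_compose c[symmetric] by (simp add: mult_ac)
      also have "\<dots> = z p * l p * euler_factor (2 * (2 * d)) (\<lambda>k. 1)"
        unfolding b l z euler_factor_conj[OF d] ..
      finally show ?thesis using 3(1) unfolding b euler_factor_compose by (simp add: mult_ac)
    qed
  qed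
  \<comment> \<open>The two trivial factors are the L-function at \<open>u^2\<close> and at
    \<open>u\<close>; they are kept so that both sides have the shape of the finite
    products.\<close>
  have main: "B_series * B_series * (1 oo fps_X ^ 2) = Z * (B_series oo fps_X ^ 2) * 1 * (1 + fps_X)"
  proof (rule fps_ext)
    fix n :: nat
    \<comment> \<open>At least 1, so that \<open>T\<close> is among the primes and contributes its
      factor \<open>1 + u\<close> also when \<open>n = 0\<close>.\<close>
    define N where "N = max 1 n"
    let ?S = "mprimes_upto N"
    have X: "X \<in> ?S" unfolding mprimes_upto_def N_def using mprime_X by (simp add: var_def)
    have comp: "(\<Prod>p\<in>?S. f p) oo fps_X ^ 2 = (\<Prod>p\<in>?S. f p oo fps_X ^ 2)" for f :: "'a list \<Rightarrow> real fps"
      by (rule fps_compose_prod_distrib) simp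
    have "(\<Prod>p\<in>?S. b p) * (\<Prod>p\<in>?S. b p) * ((\<Prod>p\<in>?S. l p) oo fps_X ^ 2) = (\<Prod>p\<in>?S. b p * b p * (l p oo fps_X ^ 2))"
      unfolding comp by (simp add: prod.distrib)
    also have "\<dots> = (\<Prod>p\<in>?S. z p * (b p oo fps_X ^ 2) * l p * (if p = X then 1 + fps_X else 1))"
      by (intro prod.cong refl factor_eq) (simp add: mprimes_upto_def)
    also have "\<dots> = (\<Prod>p\<in>?S. z p) * ((\<Prod>p\<in>?S. b p) oo fps_X ^ 2) * (\<Prod>p\<in>?S. l p) * (1 + fps_X)"
      unfolding comp using X finite_mprimes_upto by (simp add: prod.distrib prod.delta)
    finally have e: "(\<Prod>p\<in>?S. b p) * (\<Prod>p\<in>?S. b p) * ((\<Prod>p\<in>?S. l p) oo fps_X ^ 2) =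
      (\<Prod>p\<in>?S. z p) * ((\<Prod>p\<in>?S. b p) oo fps_X ^ 2) * (\<Prod>p\<in>?S. l p) * (1 + fps_X)" .
    have "fps_agree N ((\<Prod>p\<in>?S. b p) * (\<Prod>p\<in>?S. b p) * ((\<Prod>p\<in>?S. l p) oo fps_X ^ 2))
      (B_series * B_series * (1 oo fps_X ^ 2))"
      by (intro fps_agree_mult fps_agree_compose B L)
    moreover have "fps_agree N ((\<Prod>p\<in>?S. z p) * ((\<Prod>p\<in>?S. b p) oo fps_X ^ 2) * (\<Prod>p\<in>?S. l p) * (1 + fps_X))
      (Z * (B_series oo fps_X ^ 2) * 1 * (1 + fps_X))"
      by (intro fps_agree_mult fps_agree_compose B L Z fps_agree_refl)
    moreover have "n \<le> N" unfolding N_def by simp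
    ultimately show "(B_series * B_series * (1 oo fps_X ^ 2)) $ n = (Z * (B_series oo fps_X ^ 2) * 1 * (1 + fps_X)) $ n"
      unfolding e fps_agree_def by metis
  qed
  have ZY: "Z * (1 - fps_const (real (order R)) * fps_X) = 1"
  proof (rule fps_ext)
    fix n show "(Z * (1 - fps_const (real (order R)) * fps_X)) $ n = 1 $ n"
      unfolding Z_def by (cases n) (simp_all add: right_diff_distrib mult.left_commute[of _ "fps_const c" for c])
  qed
  have "B_series ^ 2 * (1 - fps_const (real (order R)) * fps_X)
    = (Z * (1 - fps_const (real (order R)) * fps_X)) * ((1 + fps_X) * (B_series oo fps_X ^ 2))"
    using main by (simp add: power2_eq_square mult_ac)
  then show ?thesis unfolding ZY by simp
qed

lemma B_series_0: "B_series $ 0 = 1"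
proof -
  have "monic_polys R 0 = {\<one>\<^bsub>P\<^esub>}" unfolding monic_polys_eq using monic_degree_0 monic_one by (auto simp: univ_poly_one)
  then show ?thesis
    using UP.qform_square[OF X_carrier UP.one_closed] by (simp add: B_series_def B_count_def b_ind_eq)
qed

end

section \<open>Asymptotics of the coefficients\<close>

text \<open>The coefficient of \<open>u^n\<close> in \<open>(1 - u)^(-1/2)\<close>.\<close>

definition central_ratio :: "nat \<Rightarrow> real" where
  "central_ratio n = real ((2 * n) choose n) / 4 ^ n"

lemma central_ratio_0 [simp]: "central_ratio 0 = 1"
  by (simp add: central_ratio_def)

lemma central_ratio_Suc: "2 * real (Suc n) * central_ratio (Suc n) = (2 * real n + 1) * central_ratio n"
proof -
  have "Suc n * ((2 * Suc n) choose Suc n) = 2 * (2 * n + 1) * ((2 * n) choose n)"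
  proof -
    have a: "Suc n * ((2 * n + 2) choose Suc n) = (2 * n + 2) * ((2 * n + 1) choose n)"
      using Suc_times_binomial[of n "2 * n + 1"] by simp
    have "Suc n * ((2 * n + 1) choose Suc n) = (2 * n + 1) * ((2 * n) choose n)"
      using Suc_times_binomial[of n "2 * n"] by simp
    moreover have "(2 * n + 1) choose Suc n = (2 * n + 1) choose n"
      using binomial_symmetric[of n "2 * n + 1"] by simp
    ultimately have "Suc n * ((2 * n + 1) choose n) = (2 * n + 1) * ((2 * n) choose n)" by simp
    then show ?thesis using a by (simp add: algebra_simps)
  qed
  then have "real (Suc n) * real ((2 * Suc n) choose Suc n) = 2 * (2 * real n + 1) * real ((2 * n) choose n)"
    by (drule_tac arg_cong[of _ _ real]) (simp only: of_nat_mult of_nat_add of_nat_numeral of_nat_1)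
  note E = this
  have aux: "2 * u * (B / (4 * P)) = a * (C / P)" if "u * B = 2 * a * C" "P \<noteq> 0" for u B P a C :: real
    using that by (simp add: field_simps)
  show ?thesis unfolding central_ratio_def power_Suc by (rule aux[OF E]) simp
qed

lemma central_ratio_pos: "central_ratio n > 0"
  by (simp add: central_ratio_def)

text \<open>The left side is 1 at \<open>n = 0\<close> and does not increase: consecutive values
  have ratio \<open>(2n+1)^2 (n+2) / (4 (n+1)^3)\<close>, which is at most 1. Using
  \<open>n + 1\<close> instead of \<open>n\<close> gives a bound that is also meaningful at
  0.\<close>

lemma central_ratio_sq_le: "(central_ratio n)\<^sup>2 * real (n + 1) \<le> 1"
proof (induction n)
  case (Suc n)
  have e: "central_ratio (Suc n) = (2 * real n + 1) * central_ratio n / (2 * real (Suc n))"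
    using central_ratio_Suc[of n] by (simp add: field_simps)
  have "(central_ratio (Suc n))\<^sup>2 * real (Suc n + 1) =
      ((2 * real n + 1)\<^sup>2 * (real n + 2) / (4 * (real n + 1) ^ 3)) * ((central_ratio n)\<^sup>2 * real (n + 1))"
  proof -
    have aux: "(a * c / (2 * u))\<^sup>2 * b = (a\<^sup>2 * b / (4 * u ^ 3)) * (c\<^sup>2 * u)" if "u \<noteq> 0" for a b c u :: real
      using that by (simp add: field_simps power2_eq_square power3_eq_cube)
    show ?thesis
      unfolding e using aux[of "real n + 1" "2 * real n + 1" "central_ratio n" "real n + 2"] by (simp add: add_ac)
  qed
  also have "\<dots> \<le> 1 * 1"
  proof (intro mult_mono Suc)
    have "(2 * real n + 1)\<^sup>2 * (real n + 2) \<le> 4 * (real n + 1) ^ 3"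
      by (simp add: power2_eq_square power3_eq_cube algebra_simps)
    then show "(2 * real n + 1)\<^sup>2 * (real n + 2) / (4 * (real n + 1) ^ 3) \<le> 1" by simp
  qed auto
  finally show ?case by simp
qed simp

lemma central_ratio_le: "central_ratio n \<le> 1 / sqrt (real (n + 1))"
proof -
  have "(central_ratio n)\<^sup>2 \<le> 1 / real (n + 1)"
    using central_ratio_sq_le[of n] by (simp add: pos_le_divide_eq)
  then have "sqrt ((central_ratio n)\<^sup>2) \<le> sqrt (1 / real (n + 1))" by (rule real_sqrt_le_mono)
  then have "central_ratio n \<le> sqrt (1 / real (n + 1))" using central_ratio_pos[of n] by simp
  then show ?thesis by (simp add: real_sqrt_divide)
qed

text \<open>An exact form of the link with Wallis's product: the partial products tend to
  \<open>pi / 2\<close>, so \<open>n\<close> times the squared ratio tends to \<open>1 / pi\<close>.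
  This is where the constant of the theorem comes from.\<close>

lemma central_ratio_wallis:
  "(central_ratio n)\<^sup>2 * (2 * real n + 1) * (\<Prod>k=1..n. (4 * real k ^ 2) / (4 * real k ^ 2 - 1)) = 1"
proof (induction n)
  case (Suc n)
  have e: "central_ratio (Suc n) = (2 * real n + 1) * central_ratio n / (2 * real (Suc n))"
    using central_ratio_Suc[of n] by (simp add: field_simps)
  let ?w = "\<Prod>k=1..n. (4 * real k ^ 2) / (4 * real k ^ 2 - 1)"
  have f: "4 * (real (Suc n))\<^sup>2 - 1 = (2 * real n + 1) * (2 * real n + 3)"
    by (simp add: power2_eq_square algebra_simps)
  have "(central_ratio (Suc n))\<^sup>2 * (2 * real (Suc n) + 1) * (\<Prod>k=1..Suc n. (4 * real k ^ 2) / (4 * real k ^ 2 - 1))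
    = ((2 * real n + 1) * central_ratio n / (2 * real (Suc n)))\<^sup>2 * (2 * real n + 3) * (?w * (4 * (real (Suc n))\<^sup>2 / ((2 * real n + 1) * (2 * real n + 3))))"
    unfolding e prod.cl_ivl_Suc f by (simp add: algebra_simps)
  also have "\<dots> = (central_ratio n)\<^sup>2 * (2 * real n + 1) * ?w"
  proof -
    have aux: "(a * c / (2 * u))\<^sup>2 * t * (w * (4 * u\<^sup>2 / (a * t))) = c\<^sup>2 * a * w"
      if "a \<noteq> 0" "t \<noteq> 0" "u \<noteq> 0" for a c t u w :: real
      using that by (simp add: field_simps power2_eq_square)
    have "2 * real n + 1 \<noteq> 0" "2 * real n + 3 \<noteq> 0" "real (Suc n) \<noteq> 0" by linarith+
    then show ?thesis by (rule aux)
  qed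
  also have "\<dots> = 1" by (rule Suc.IH)
  finally show ?case .
qed simp

lemma central_ratio_asymptotic: "(\<lambda>n. sqrt (real n) * central_ratio n) \<longlonglongrightarrow> 1 / sqrt pi"
proof -
  let ?w = "\<lambda>n. \<Prod>k=1..n. (4 * real k ^ 2) / (4 * real k ^ 2 - 1)"
  have l: "(\<lambda>n. real n / (2 * real n + 1)) \<longlonglongrightarrow> 1 / 2" by real_asymp
  have "(\<lambda>n. (real n / (2 * real n + 1)) * inverse (?w n)) \<longlonglongrightarrow> 1 / 2 * inverse (pi / 2)"
    by (intro tendsto_mult l tendsto_inverse wallis) simp
  then have "(\<lambda>n. sqrt ((real n / (2 * real n + 1)) * inverse (?w n))) \<longlonglongrightarrow> sqrt (1 / 2 * inverse (pi / 2))"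
    by (rule tendsto_real_sqrt)
  moreover have "sqrt ((real n / (2 * real n + 1)) * inverse (?w n)) = sqrt (real n) * central_ratio n" for n
  proof -
    have "((2 * real n + 1) * ?w n) * (central_ratio n)\<^sup>2 = 1"
      using central_ratio_wallis[of n] by (simp only: mult_ac)
    then have "inverse ((2 * real n + 1) * ?w n) = (central_ratio n)\<^sup>2" by (rule inverse_unique)
    then have "(real n / (2 * real n + 1)) * inverse (?w n) = real n * (central_ratio n)\<^sup>2"
      by (simp only: divide_inverse inverse_mult_distrib mult.assoc)
    then show ?thesis using central_ratio_pos[of n] by (simp add: real_sqrt_mult)
  qed
  moreover have "sqrt (1 / 2 * inverse (pi / 2)) = 1 / sqrt pi"
    by (simp add: real_sqrt_divide field_simps)
  ultimately show ?thesis by simp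
qed

section \<open>Solving the functional equation by formal power series\<close>

lemma fps_compose_X_power_X: "((fps_X :: real fps) oo fps_X ^ 2) = fps_X ^ 2"
  by (rule fps_X_fps_compose_startby0) simp

lemma numeral_mult_nth: "(2 * f) $ n = 2 * (f $ n)" for f :: "real fps"
  by (simp add: fps_numeral_fps_const)

text \<open>In terms of \<open>L = X D' / D\<close> the functional equation is linear: \<open>L = A + L(X\<^sup>2)\<close> with \<open>A\<close> explicit.\<close>

lemma functional_equation_expansion:
  fixes D :: "real fps" and q :: real
  assumes D0: "D $ 0 = 1" and q: "q \<ge> 1"
    and eq: "D ^ 2 * (1 - fps_const q * fps_X) = (1 + fps_X) * (D oo fps_X ^ 2)"
  obtains h where "h 0 = 1" "\<And>k. 0 \<le> h k" "\<And>k. h k \<le> sqrt q ^ k"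
    "\<And>n. D $ n = (\<Sum>k\<le>n. h k * (central_ratio (n - k) * q ^ (n - k)))"
proof -
  define \<rho> where "\<rho> = sqrt q"
  have rho: "\<rho> \<ge> 1" "\<rho> * \<rho> = q" using q by (auto simp: \<rho>_def)
  let ?X = "fps_X :: real fps"
  define qc where "qc = fps_const q"
  have dqc: "fps_deriv qc = 0" and qc_nth: "(qc * f) $ n = q * f $ n" for f n unfolding qc_def by simp_all
  define Y where "Y = 1 - qc * ?X"
  have dY: "fps_deriv Y = - qc" unfolding Y_def by (simp add: dqc)
  have Y0: "Y $ 0 = 1" unfolding Y_def by (simp add: qc_nth)
  have cX: "fps_compose f (?X ^ 2) $ 0 = f $ 0" for f by (simp add: fps_nth_compose_X_power)
  define L where "L = ?X * fps_deriv D * inverse D"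
  have LD: "L * D = ?X * fps_deriv D"
    unfolding L_def using D0 by (simp add: mult.assoc inverse_mult_eq_1)
  define L2 where "L2 = L oo ?X ^ 2"
  define D2 where "D2 = D oo ?X ^ 2"
  have eq': "D ^ 2 * Y = (1 + ?X) * D2" using eq unfolding Y_def D2_def qc_def .
  have dD2: "?X * fps_deriv D2 = 2 * (L2 * D2)"
  proof -
    have "fps_deriv D2 = (fps_deriv D oo ?X ^ 2) * fps_deriv (?X ^ 2)"
      unfolding D2_def by (rule fps_compose_deriv) simp
    also have "fps_deriv (?X ^ 2) = 2 * ?X" by (simp add: power2_eq_square)
    finally have "?X * fps_deriv D2 = 2 * (?X ^ 2 * (fps_deriv D oo ?X ^ 2))"
      by (simp add: power2_eq_square algebra_simps)
    also have "?X ^ 2 * (fps_deriv D oo ?X ^ 2) = (?X * fps_deriv D) oo ?X ^ 2"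
      by (simp add: fps_compose_mult_distrib fps_compose_X_power_X)
    also have "\<dots> = L2 * D2" unfolding L2_def D2_def LD[symmetric] by (simp add: fps_compose_mult_distrib)
    finally show ?thesis .
  qed
  have "fps_deriv (D ^ 2 * Y) = fps_deriv ((1 + ?X) * D2)" unfolding eq' ..
  then have "2 * D * fps_deriv D * Y - qc * D ^ 2 = D2 + (1 + ?X) * fps_deriv D2"
    by (simp add: dY power2_eq_square algebra_simps)
  \<comment> \<open>The factor \<open>X\<close> turns derivatives into \<open>X D'\<close>, and
    \<open>1 + X\<close> allows \<open>(1 + X) D2\<close> to be replaced by \<open>D^2 Y\<close>
    everywhere, so that \<open>D^2\<close> can be cancelled.\<close>
  then have "?X * (1 + ?X) * (2 * D * fps_deriv D * Y - qc * D ^ 2) = ?X * (1 + ?X) * (D2 + (1 + ?X) * fps_deriv D2)"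
    by simp
  then have "2 * D * (1 + ?X) * Y * (?X * fps_deriv D) - qc * ?X * (1 + ?X) * D ^ 2
      = ?X * ((1 + ?X) * D2) + (1 + ?X) * (1 + ?X) * (?X * fps_deriv D2)"
    by (simp add: algebra_simps)
  then have "2 * D * (1 + ?X) * Y * (L * D) - qc * ?X * (1 + ?X) * D ^ 2
      = ?X * (D ^ 2 * Y) + (1 + ?X) * 2 * L2 * (D ^ 2 * Y)"
    unfolding LD dD2 eq' by (simp add: algebra_simps)
  then have "D ^ 2 * (2 * L * (1 + ?X) * Y - qc * ?X * (1 + ?X)) = D ^ 2 * (?X * Y + (1 + ?X) * 2 * L2 * Y)"
    by (simp add: algebra_simps power2_eq_square)
  moreover have "D ^ 2 \<noteq> 0" using D0 by auto
  ultimately have "2 * L * (1 + ?X) * Y - qc * ?X * (1 + ?X) = ?X * Y + (1 + ?X) * 2 * L2 * Y"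
    using mult_left_cancel by blast
  then have key: "2 * L * (1 + ?X) * Y = qc * ?X * (1 + ?X) + ?X * Y + 2 * L2 * (1 + ?X) * Y"
    by (simp add: algebra_simps)
  \<comment> \<open>\<open>Q = qX/(1 - qX)\<close> and \<open>S = X/(1 + X)\<close> are the
    logarithmic derivatives, multiplied by \<open>X\<close>, of \<open>1/(1 - qX)\<close> and
    \<open>1 + X\<close>.\<close>
  define Q where "Q = Abs_fps (\<lambda>n. if n = 0 then 0 else q ^ n)"
  define S where "S = Abs_fps (\<lambda>n. if n = 0 then 0 else - ((-1) ^ n :: real))"
  have QY: "Q * Y = qc * ?X"
  proof (rule fps_ext)
    fix n show "(Q * Y) $ n = (qc * ?X) $ n"
      unfolding Y_def Q_def by (cases n) (simp_all add: right_diff_distrib qc_def mult.left_commute[of _ "fps_const q"])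
  qed
  have SX: "S * (1 + ?X) = ?X"
  proof (rule fps_ext)
    fix n show "(S * (1 + ?X)) $ n = ?X $ n"
      unfolding S_def by (cases n) (auto simp: distrib_left fps_X_nth)
  qed
  have "(1 + ?X) * Y * (2 * L - Q - S - 2 * L2) = 0"
  proof -
    have "(1 + ?X) * Y * (2 * L - Q - S - 2 * L2)
      = 2 * L * (1 + ?X) * Y - (Q * Y) * (1 + ?X) - (S * (1 + ?X)) * Y - 2 * L2 * (1 + ?X) * Y" by (simp add: algebra_simps)
    then show ?thesis unfolding QY SX key by simp
  qed
  moreover have "(1 + ?X) * Y \<noteq> 0"
  proof -
    have "((1 + ?X) * Y) $ 0 = 1" using Y0 by simp
    then show ?thesis by (metis fps_zero_nth zero_neq_one)
  qed
  ultimately have "2 * L - Q - S - 2 * L2 = 0" by (metis mult_eq_0_iff)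
  then have lin: "2 * L = Q + S + 2 * L2" by (simp add: algebra_simps)
  \<comment> \<open>Subtracting \<open>Q/2\<close> removes the contribution of
    \<open>(1 - qX)^(-1/2)\<close>; \<open>E\<close> will be \<open>X H' / H\<close>.\<close>
  define E where "E = L - fps_const (1/2) * Q"
  have E0: "E $ 0 = 0" unfolding E_def L_def Q_def by simp
  have L_nth: "2 * L $ n = q ^ n - (- 1) ^ n + (if even n then 2 * L $ (n div 2) else 0)" if "n \<ge> 1" for n
  proof -
    have "(2 * L) $ n = (Q + S + 2 * L2) $ n" unfolding lin ..
    then show ?thesis using that unfolding L2_def Q_def S_def
      by (simp add: fps_nth_compose_X_power fps_numeral_nth fps_numeral_fps_const)
  qed
  have E_nth: "E $ n = L $ n - q ^ n / 2" if "n \<ge> 1" for n using that unfolding E_def Q_def by simp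
  have E_bd: "0 \<le> E $ n \<and> E $ n \<le> \<rho> ^ n" for n
  proof (induction n rule: less_induct)
    case (less n)
    consider "n = 0" | "odd n" | m where "n = 2 * m" "m \<ge> 1"
      by (metis One_nat_def Suc_leI evenE gr0I mult_0_right)
    then show ?case
    proof cases
      case 1 then show ?thesis using E0 by simp
    next
      case 2
      then have n1: "n \<ge> 1" by (cases n) auto
      have "E $ n = 1 / 2" using L_nth[OF n1] E_nth[OF n1] 2 by simp
      moreover have "\<rho> ^ n \<ge> 1" using rho by simp
      ultimately show ?thesis by simp
    next
      case 3
      then have n1: "n \<ge> 1" by simp
      have IH: "0 \<le> E $ m" "E $ m \<le> \<rho> ^ m" using less[of m] 3 by auto
      have "E $ n = L $ m - 1 / 2" using L_nth[OF n1] E_nth[OF n1] 3 by simp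
      then have En: "E $ n = E $ m + q ^ m / 2 - 1 / 2" using E_nth[OF 3(2)] by simp
      have "q ^ m \<ge> 1" using q by simp
      moreover have "q ^ m = \<rho> ^ n" unfolding rho(2)[symmetric] 3(1) by (simp add: power_mult power2_eq_square)
      \<comment> \<open>The recursion at \<open>n = 2m\<close> adds \<open>(q^m - 1)/2\<close> to
        \<open>E $ m\<close>. By the arithmetic-geometric mean inequality \<open>\<rho>^m\<close> is
        at most \<open>(q^m + 1)/2\<close>, so the sum stays below
        \<open>q^m = \<rho>^n\<close>.\<close>
      moreover have "\<rho> ^ m \<le> (\<rho> ^ m)\<^sup>2 / 2 + 1 / 2"
        using zero_le_power2[of "\<rho> ^ m - 1"] by (simp add: power2_eq_square algebra_simps)
      moreover have "(\<rho> ^ m)\<^sup>2 = \<rho> ^ n" unfolding 3(1) by (metis mult.commute power_mult)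
      ultimately show ?thesis using En IH by linarith
    qed
  qed
  \<comment> \<open>This is \<open>(1 - qX)^(-1/2)\<close>. The recurrence of
    \<open>central_ratio\<close> is its differential equation, which makes \<open>W * W * Y\<close>
    constant.\<close>
  define W where "W = Abs_fps (\<lambda>n. central_ratio n * q ^ n)"
  have dW: "2 * fps_deriv W * Y = qc * W"
  proof (rule fps_ext)
    fix n
    have r: "2 * (real n + 1) * central_ratio (Suc n) = (2 * real n + 1) * central_ratio n" for n
      using central_ratio_Suc[of n] by (simp add: algebra_simps)
    have "(2 * fps_deriv W * Y) $ n = 2 * (fps_deriv W $ n) - 2 * q * (if n = 0 then 0 else fps_deriv W $ (n - 1))"
      unfolding Y_def by (simp add: right_diff_distrib qc_nth mult.assoc mult.left_commute[of _ qc] fps_numeral_nth_0 numeral_mult_nth)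
    also have "\<dots> = (2 * (real n + 1) * central_ratio (Suc n) - 2 * real n * central_ratio n) * q ^ Suc n"
      unfolding W_def by (cases n) (simp_all add: algebra_simps)
    also have "\<dots> = central_ratio n * q ^ Suc n" unfolding r by (simp add: algebra_simps)
    finally show "(2 * fps_deriv W * Y) $ n = (qc * W) $ n" unfolding W_def by (simp add: qc_nth)
  qed
  have W0: "W $ 0 = 1" unfolding W_def by simp
  have WWY: "W * W * Y = 1"
  proof -
    have "fps_deriv (W * W * Y) = W * (2 * fps_deriv W * Y) - qc * (W * W)"
      by (simp add: dY algebra_simps)
    also have "\<dots> = 0" unfolding dW by (simp add: algebra_simps)
    finally have "fps_deriv (W * W * Y) = 0" .
    then have "W * W * Y = fps_const ((W * W * Y) $ 0)" using fps_deriv_eq_0_iff by blast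
    then show ?thesis using W0 Y0 by simp
  qed
  \<comment> \<open>Since \<open>W * W * Y = 1\<close>, the series \<open>W * Y\<close> is the
    inverse of \<open>W\<close>; thus \<open>H = D / W\<close> without a formal division.\<close>
  define H where "H = D * W * Y"
  have HW: "D = H * W"
  proof -
    have "H * W = D * (W * W * Y)" unfolding H_def by (simp add: algebra_simps)
    then show ?thesis unfolding WWY by simp
  qed
  have dH: "?X * fps_deriv H = E * H"
  proof -
    have "2 * (?X * fps_deriv H) = 2 * (?X * fps_deriv D) * W * Y + ?X * D * (2 * fps_deriv W * Y) - 2 * qc * ?X * D * W"
      unfolding H_def by (simp add: dY algebra_simps)
    also have "\<dots> = 2 * (L * D) * W * Y - (Q * Y) * D * W"
      unfolding dW LD QY by (simp add: algebra_simps)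
    also have "\<dots> = 2 * (E * H)"
    proof -
      have "2 * E = 2 * L - Q" unfolding E_def by (simp add: fps_numeral_fps_const right_diff_distrib flip: mult.assoc fps_const_mult)
      then have "2 * (E * H) = (2 * L - Q) * H" by (simp flip: mult.assoc)
      then show ?thesis unfolding H_def by (simp add: algebra_simps)
    qed
    finally show ?thesis by simp
  qed
  have H0: "H $ 0 = 1" unfolding H_def using D0 W0 Y0 by simp
  have H_rec: "real n * H $ n = (\<Sum>i=1..n. E $ i * H $ (n - i))" if "n \<ge> 1" for n
  proof -
    have "real n * H $ n = (?X * fps_deriv H) $ n" using that by (cases n) auto
    also have "\<dots> = (\<Sum>i=0..n. E $ i * H $ (n - i))" unfolding dH fps_mult_nth ..
    also have "\<dots> = (\<Sum>i=1..n. E $ i * H $ (n - i))" using E0 by (simp add: sum.atLeast_Suc_atMost)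
    finally show ?thesis .
  qed
  have H_bd: "0 \<le> H $ n \<and> H $ n \<le> \<rho> ^ n" for n
  proof (induction n rule: less_induct)
    case (less n)
    show ?case
    proof (cases "n = 0")
      case True then show ?thesis using H0 by simp
    next
      case False
      then have n1: "n \<ge> 1" by simp
      have IH: "0 \<le> H $ (n - i)" "H $ (n - i) \<le> \<rho> ^ (n - i)" if "i \<in> {1..n}" for i
        using less[of "n - i"] that by auto
      have "0 \<le> real n * H $ n" unfolding H_rec[OF n1] using IH E_bd by (intro sum_nonneg mult_nonneg_nonneg) auto
      moreover have "real n * H $ n \<le> (\<Sum>i=1..n. \<rho> ^ i * \<rho> ^ (n - i))"
        unfolding H_rec[OF n1] using IH E_bd rho by (intro sum_mono mult_mono) auto
      \<comment> \<open>All \<open>n\<close> summands have the same bound \<open>\<rho>^n\<close>,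
        so their number exactly cancels the factor \<open>n\<close> produced by the
        derivative.\<close>
      moreover have "(\<Sum>i=1..n. \<rho> ^ i * \<rho> ^ (n - i)) = real n * \<rho> ^ n"
        by (simp flip: power_add)
      ultimately show ?thesis using n1 by (auto simp: zero_le_mult_iff)
    qed
  qed
  show ?thesis
  proof (rule that[of "\<lambda>n. H $ n"])
    fix n
    show "D $ n = (\<Sum>k\<le>n. H $ k * (central_ratio (n - k) * q ^ (n - k)))"
      unfolding HW fps_mult_nth W_def by (simp add: atLeast0AtMost)
  qed (use H0 H_bd \<rho>_def in auto)
qed

text \<open>Dominated convergence for series (Tannery): for each fixed \<open>k\<close> the shift by
  \<open>k\<close> does not change the limit \<open>1 / sqrt pi\<close>, and the geometric decay of
  \<open>g\<close> absorbs the loss caused by the shift.\<close>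

lemma convolution_central_ratio_limit:
  fixes g :: "nat \<Rightarrow> real"
  assumes g: "\<And>k. 0 \<le> g k" "\<And>k. g k \<le> r ^ k" and r: "r < 1"
  shows "(\<lambda>n. sqrt (real n) * (\<Sum>k\<le>n. g k * central_ratio (n - k))) \<longlonglongrightarrow> (\<Sum>k. g k) / sqrt pi"
proof -
  have r0: "0 \<le> r" using g(1)[of 1] g(2)[of 1] by simp
  define a where "a k n = (if k \<le> n then sqrt (real n) * (g k * central_ratio (n - k)) else 0)" for k n
  have lim: "(\<lambda>n. a k n) \<longlonglongrightarrow> g k * (1 / sqrt pi)" for k
  proof -
    have s: "(\<lambda>n. sqrt (real (n + k) / real n)) \<longlonglongrightarrow> 1" by real_asymp
    have "(\<lambda>n. g k * (sqrt (real (n + k) / real n) * (sqrt (real n) * central_ratio n))) \<longlonglongrightarrow> g k * (1 * (1 / sqrt pi))"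
      by (intro tendsto_mult tendsto_const s central_ratio_asymptotic)
    moreover have "eventually (\<lambda>n. g k * (sqrt (real (n + k) / real n) * (sqrt (real n) * central_ratio n)) = a k (n + k)) sequentially"
      using eventually_gt_at_top[of 0] by eventually_elim (simp add: a_def real_sqrt_divide)
    ultimately have "(\<lambda>n. a k (n + k)) \<longlonglongrightarrow> g k * (1 / sqrt pi)"
      by (simp add: tendsto_cong)
    then show ?thesis by (rule LIMSEQ_offset)
  qed
  \<comment> \<open>The shift costs at most \<open>sqrt (k + 1)\<close>. The weaker factor
    \<open>k + 1\<close> makes the majorant the derivative of the geometric series, hence
    summable.\<close>
  define M where "M k = real (k + 1) * r ^ k" for k
  have bd: "norm (a k n) \<le> M k" for k n
  proof (cases "k \<le> n")
    case True
    have "real n \<le> real (k + 1) * real (n - k + 1)"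
    proof -
      \<comment> \<open>The right side exceeds \<open>n\<close> by
        \<open>k * (n - k) + 1\<close>.\<close>
      have "n \<le> (k + 1) * (n - k + 1)" using True by (auto simp: le_iff_add algebra_simps)
      then show ?thesis by (simp only: of_nat_mult[symmetric] of_nat_le_iff)
    qed
    then have "sqrt (real n) \<le> sqrt (real (k + 1)) * sqrt (real (n - k + 1))"
      by (simp only: real_sqrt_mult[symmetric] real_sqrt_le_iff)
    then have "sqrt (real n) * central_ratio (n - k) \<le> (sqrt (real (k + 1)) * sqrt (real (n - k + 1))) * (1 / sqrt (real (n - k + 1)))"
      using central_ratio_le[of "n - k"] central_ratio_pos[of "n - k"] by (intro mult_mono) auto
    also have "\<dots> = sqrt (real (k + 1))" by simp
    also have "\<dots> \<le> real (k + 1)" by (rule real_le_lsqrt) (auto simp: power2_eq_square)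
    finally have "g k * (sqrt (real n) * central_ratio (n - k)) \<le> r ^ k * real (k + 1)"
      using g r0 central_ratio_pos[of "n - k"] by (intro mult_mono) auto
    then show ?thesis using True g(1)[of k] central_ratio_pos[of "n - k"] by (simp add: a_def M_def algebra_simps)
  qed (use r0 in \<open>simp add: a_def M_def\<close>)
  have sM: "summable M"
  proof -
    have "summable (\<lambda>n. diffs (\<lambda>_. 1) n * r ^ n)"
      by (rule termdiff_converges[of r 1]) (use r r0 in \<open>auto intro: summable_geometric\<close>)
    then show ?thesis by (simp add: diffs_def M_def[abs_def])
  qed
  have "(\<lambda>n. \<Sum>k. a k n) \<longlonglongrightarrow> (\<Sum>k. g k * (1 / sqrt pi))"
  proof -
    have "eventually (\<lambda>(k, n). norm (a k n) \<le> M k) (sequentially \<times>\<^sub>F sequentially)"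
      by (rule always_eventually) (use bd in auto)
    from tannerys_theorem[OF lim this sM] show ?thesis by simp
  qed
  moreover have "(\<Sum>k. a k n) = sqrt (real n) * (\<Sum>k\<le>n. g k * central_ratio (n - k))" for n
  proof -
    have "(\<Sum>k. a k n) = (\<Sum>k\<le>n. a k n)" by (rule suminf_finite) (auto simp: a_def)
    then show ?thesis by (simp add: a_def sum_distrib_left)
  qed
  moreover have "(\<Sum>k. g k * (1 / sqrt pi)) = (\<Sum>k. g k) / sqrt pi"
  proof -
    have "summable g" by (rule summable_comparison_test'[of "\<lambda>k. r ^ k" 0]) (use g r r0 in \<open>auto intro: summable_geometric\<close>)
    then show ?thesis using suminf_mult2[of g "1 / sqrt pi"] by simp
  qed
  ultimately show ?thesis by simp
qed

section \<open>The iterated limits\<close>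

text \<open>Both limits are read off from this exact formula, whose bound on \<open>g\<close>
  depends on \<open>q\<close> only through \<open>1 / sqrt q\<close>. At \<open>n = 0\<close> both
  sides are 0, by the convention for division by zero on the left.\<close>

lemma (in odd_finite_field) B_count_expansion:
  "\<exists>g. g 0 = 1 \<and> (\<forall>k. 0 \<le> g k \<and> g k \<le> (1 / sqrt (real (order R))) ^ k) \<and>
    (\<forall>n. real (B_count R n) / (real (order R) ^ n / sqrt (real n)) =
      sqrt (real n) * (\<Sum>k\<le>n. g k * central_ratio (n - k)))"
proof -
  let ?q = "real (order R)"
  have q: "?q \<ge> 1" using order_gt_2 by simp
  obtain h where h: "h 0 = 1" "\<And>k. 0 \<le> h k" "\<And>k. h k \<le> sqrt ?q ^ k"
    "\<And>n. B_series $ n = (\<Sum>k\<le>n. h k * (central_ratio (n - k) * ?q ^ (n - k)))"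
    using functional_equation_expansion[OF B_series_0 q B_series_functional_equation] by blast
  let ?g = "\<lambda>k. h k / ?q ^ k"
  have "?g k \<le> (1 / sqrt ?q) ^ k" for k
  proof -
    have "?g k \<le> sqrt ?q ^ k / ?q ^ k" using h(3)[of k] q by (intro divide_right_mono) auto
    also have "\<dots> = (sqrt ?q / ?q) ^ k" by (simp add: power_divide)
    also have "sqrt ?q / ?q = 1 / sqrt ?q" using q by (simp add: real_div_sqrt field_simps)
    finally show ?thesis .
  qed
  moreover have "real (B_count R n) / (?q ^ n / sqrt (real n)) = sqrt (real n) * (\<Sum>k\<le>n. ?g k * central_ratio (n - k))" for n
  proof -
    have "real (B_count R n) = ?q ^ n * (\<Sum>k\<le>n. ?g k * central_ratio (n - k))"
    proof -
      have "h k * (central_ratio (n - k) * ?q ^ (n - k)) = ?q ^ n * (?g k * central_ratio (n - k))" if "k \<le> n" for k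
      proof -
        have "?q ^ n = ?q ^ k * ?q ^ (n - k)" using that by (simp flip: power_add)
        then show ?thesis using q by simp
      qed
      then have "(\<Sum>k\<le>n. h k * (central_ratio (n - k) * ?q ^ (n - k))) = (\<Sum>k\<le>n. ?q ^ n * (?g k * central_ratio (n - k)))"
        by (intro sum.cong) auto
      then show ?thesis using h(4)[of n] by (simp add: B_series_def sum_distrib_left)
    qed
    then show ?thesis using q by simp
  qed
  ultimately show ?thesis using h(1,2) q by (intro exI[of _ ?g]) auto
qed

lemma tendsto_odd_prime_powers:
  "(f \<longlongrightarrow> l) at_top \<Longrightarrow> (f \<longlongrightarrow> l) at_top_odd_prime_powers"
  unfolding at_top_odd_prime_powers_def by (rule tendsto_mono[OF inf_le1])

lemma eventually_odd_prime_powers: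
  "(\<And>q. q \<in> odd_prime_powers \<Longrightarrow> P q) \<Longrightarrow> eventually P at_top_odd_prime_powers"
  unfolding at_top_odd_prime_powers_def by (simp add: eventually_inf_principal)

text \<open>A finite field is determined by its order only up to isomorphism, so the claim is made
  for an arbitrary choice \<open>F\<close> of one field per order. The inner limits appear as
  functions \<open>K\<close> and \<open>C\<close>, which makes their existence part of the
  claim.\<close>

theorem mainTheorem3:
  fixes F :: "nat \<Rightarrow> ('a, 'b) ring_scheme"
  assumes "\<And>q. q \<in> odd_prime_powers \<Longrightarrow> field (F q) \<and> order (F q) = q"
  shows "(\<exists>K :: nat \<Rightarrow> real.
            (\<forall>q \<in> odd_prime_powers.
               (\<lambda>n. real (B_count (F q) n) / (real q ^ n / sqrt (real n))) \<longlonglongrightarrow> K q) \<and>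
            (K \<longlongrightarrow> 1 / sqrt pi) at_top_odd_prime_powers) \<and>
         (\<exists>C :: nat \<Rightarrow> real.
            (\<forall>n \<ge> 1.
               ((\<lambda>q. real (B_count (F q) n) / (real q ^ n / sqrt (real n))) \<longlongrightarrow> C n)
                 at_top_odd_prime_powers) \<and>
            C \<longlonglongrightarrow> 1 / sqrt pi)"
proof -
  have ex: "\<forall>q\<in>odd_prime_powers. \<exists>g. g 0 = 1 \<and> (\<forall>k. 0 \<le> g k \<and> g k \<le> (1 / sqrt (real q)) ^ k) \<and>
    (\<forall>n. real (B_count (F q) n) / (real q ^ n / sqrt (real n)) =
      sqrt (real n) * (\<Sum>k\<le>n. g k * central_ratio (n - k)))"
  proof
    fix q assume q: "q \<in> odd_prime_powers"
    have F: "field (F q)" "order (F q) = q" using assms[OF q] by auto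
    have "q > 0" "odd q" using q by (auto simp: odd_prime_powers_def intro: primepow_gt_0_nat)
    \<comment> \<open>An infinite carrier would have cardinality 0 by convention, so a positive
      order forces finiteness.\<close>
    then have "finite (carrier (F q))" "odd (order (F q))"
      using F(2) unfolding order_def by (auto intro: card_ge_0_finite)
    then interpret odd_finite_field "F q" using F by (intro odd_finite_field.intro odd_finite_field_axioms.intro)
    show "\<exists>g. g 0 = 1 \<and> (\<forall>k. 0 \<le> g k \<and> g k \<le> (1 / sqrt (real q)) ^ k) \<and>
      (\<forall>n. real (B_count (F q) n) / (real q ^ n / sqrt (real n)) =
        sqrt (real n) * (\<Sum>k\<le>n. g k * central_ratio (n - k)))"
      using B_count_expansion unfolding F(2) .
  qed
  obtain G where "\<forall>q\<in>odd_prime_powers. G q 0 = 1 \<and> (\<forall>k. 0 \<le> G q k \<and> G q k \<le> (1 / sqrt (real q)) ^ k) \<and>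
    (\<forall>n. real (B_count (F q) n) / (real q ^ n / sqrt (real n)) =
      sqrt (real n) * (\<Sum>k\<le>n. G q k * central_ratio (n - k)))"
    using bchoice[OF ex] by blast
  then have G: "\<And>q. q \<in> odd_prime_powers \<Longrightarrow> G q 0 = 1"
    "\<And>q k. q \<in> odd_prime_powers \<Longrightarrow> 0 \<le> G q k"
    "\<And>q k. q \<in> odd_prime_powers \<Longrightarrow> G q k \<le> (1 / sqrt (real q)) ^ k"
    "\<And>q n. q \<in> odd_prime_powers \<Longrightarrow> real (B_count (F q) n) / (real q ^ n / sqrt (real n)) =
      sqrt (real n) * (\<Sum>k\<le>n. G q k * central_ratio (n - k))"
    by blast+
  have r: "1 / sqrt (real q) < 1" if "q \<in> odd_prime_powers" for q
    using that primepow_gt_Suc_0[of q] by (simp add: odd_prime_powers_def)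
  define K where "K q = (\<Sum>k. G q k) / sqrt pi" for q
  have "\<forall>q \<in> odd_prime_powers. (\<lambda>n. real (B_count (F q) n) / (real q ^ n / sqrt (real n))) \<longlonglongrightarrow> K q"
    unfolding K_def using G(4) convolution_central_ratio_limit[OF G(2,3) r] by simp
  moreover have "(K \<longlongrightarrow> 1 / sqrt pi) at_top_odd_prime_powers"
  proof (rule tendsto_sandwich)
    \<comment> \<open>The term \<open>k = 0\<close> alone gives the lower bound, the geometric
      majorant the upper one; both tend to 1 as \<open>q\<close> grows.\<close>
    have b: "1 \<le> (\<Sum>k. G q k) \<and> (\<Sum>k. G q k) \<le> 1 / (1 - 1 / sqrt (real q))" if q: "q \<in> odd_prime_powers" for q
    proof -
      have n: "norm (1 / sqrt (real q)) < 1" using r[OF q] by simp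
      have s: "summable (\<lambda>k. (1 / sqrt (real q)) ^ k)" using n by (rule summable_geometric)
      have sG: "summable (G q)"
        by (rule summable_comparison_test'[OF s, of 0]) (use G(2,3)[OF q] in auto)
      have "(\<Sum>k\<in>{0}. G q k) \<le> (\<Sum>k. G q k)" by (rule sum_le_suminf[OF sG]) (use G(2)[OF q] in auto)
      moreover have "(\<Sum>k. G q k) \<le> (\<Sum>k. (1 / sqrt (real q)) ^ k)" by (rule suminf_le[OF _ sG s]) (rule G(3)[OF q])
      ultimately show ?thesis using G(1)[OF q] suminf_geometric[OF n] by simp
    qed
    show "eventually (\<lambda>q. 1 / sqrt pi \<le> K q) at_top_odd_prime_powers"
      unfolding K_def by (intro eventually_odd_prime_powers divide_right_mono) (use b in auto)
    show "eventually (\<lambda>q. K q \<le> 1 / (1 - 1 / sqrt (real q)) / sqrt pi) at_top_odd_prime_powers"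
      unfolding K_def by (intro eventually_odd_prime_powers divide_right_mono) (use b in auto)
    have "(\<lambda>q. 1 / (1 - 1 / sqrt (real q))) \<longlonglongrightarrow> 1" by real_asymp
    then have "(\<lambda>q. 1 / (1 - 1 / sqrt (real q)) / sqrt pi) \<longlonglongrightarrow> 1 / sqrt pi"
      by (rule tendsto_divide) auto
    then show "((\<lambda>q. 1 / (1 - 1 / sqrt (real q)) / sqrt pi) \<longlongrightarrow> 1 / sqrt pi) at_top_odd_prime_powers"
      by (rule tendsto_odd_prime_powers)
  qed simp
  \<comment> \<open>For fixed \<open>n\<close> the sum is finite, so limits may be taken termwise;
    only \<open>k = 0\<close> survives, and the inner limit is explicit.\<close>
  moreover have "((\<lambda>q. real (B_count (F q) n) / (real q ^ n / sqrt (real n))) \<longlongrightarrow> sqrt (real n) * central_ratio n)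
    at_top_odd_prime_powers" for n
  proof -
    have Gk: "((\<lambda>q. G q k) \<longlongrightarrow> of_bool (k = 0)) at_top_odd_prime_powers" for k
    proof (cases "k = 0")
      case True
      have "eventually (\<lambda>q. of_bool (k = 0) = G q k) at_top_odd_prime_powers"
        by (rule eventually_odd_prime_powers) (use G(1) True in auto)
      then show ?thesis by (rule tendsto_eventually[OF eventually_mono]) simp
    next
      case False
      have "((\<lambda>q. 1 / sqrt (real q)) \<longlongrightarrow> 0) at_top_odd_prime_powers"
        by (rule tendsto_odd_prime_powers) real_asymp
      then have "((\<lambda>q. (1 / sqrt (real q)) ^ k) \<longlongrightarrow> 0 ^ k) at_top_odd_prime_powers" by (rule tendsto_power)
      then have z: "((\<lambda>q. (1 / sqrt (real q)) ^ k) \<longlongrightarrow> 0) at_top_odd_prime_powers" using False by (simp add: power_0_left)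
      have "((\<lambda>q. G q k) \<longlongrightarrow> 0) at_top_odd_prime_powers"
        by (rule tendsto_sandwich[OF _ _ tendsto_const z]) (rule eventually_odd_prime_powers, use G(2,3) in auto)+
      then show ?thesis using False by simp
    qed
    have "((\<lambda>q. sqrt (real n) * (\<Sum>k\<le>n. G q k * central_ratio (n - k))) \<longlongrightarrow>
      sqrt (real n) * (\<Sum>k\<le>n. of_bool (k = 0) * central_ratio (n - k))) at_top_odd_prime_powers"
      by (intro tendsto_mult tendsto_sum tendsto_const Gk)
    moreover have "(\<Sum>k\<le>n. of_bool (k = 0) * central_ratio (n - k)) = central_ratio n"
      by (simp add: of_bool_def if_distrib[of "\<lambda>x. x * _"] cong: if_cong)
    ultimately show ?thesis
      using tendsto_cong[OF eventually_odd_prime_powers[OF G(4)]] by simp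
  qed
  ultimately show ?thesis using central_ratio_asymptotic by (intro conjI exI[of _ K] exI[of _ "\<lambda>n. sqrt (real n) * central_ratio n"]) auto
qed

end
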